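(* Let $U_{0,1,T},X_{0,T},X_{1,T}$ be the data matrices of a noiseless trajectory of $x(t+1)=Ax(t)+Bu(t)$ ($x(t)\in\mathbb{R}^n$, $u(t)\in\mathbb{R}^m$), and assume $$\operatorname{rank}\begin{bmatrix}U_{0,1,T}\\ X_{0,T}\end{bmatrix}=n+m .$$ Let $H_d,F_d,G_d,W_d,S_d$ be the data-based matrices constructed in the context, and consider, for $x\in\mathbb{R}^n$, the data-driven quadratic program $$\mathrm{QP}_d(x):\qquad \min_{z\in\mathbb{R}^{mN_u}} z'H_dz\quad\text{s.t.}\quad G_dz\le W_d+S_dx .$$ Let $i=1,\dots,M$ enumerate the sets of constraints (row indices) that are exactly the active set at the optimum of $\mathrm{QP}_d(x)$ for some $x$ for which it is feasible, and let $\tilde G_{d,i},\tilde W_{d,i},\tilde S_{d,i}$ be the corresponding rows of $G_d,W_d,S_d$. Assume that, for each $i$, the rows of $\tilde G_{d,i}$ are linearly independent. Then, for every $x$ such that $\mathrm{QP}_d(x)$ is feasible, $\mathrm{QP}_d(x)$ admits one and only one solution $z(x)$, and the associated control sequence $U(x)=z(x)-H_d^{-1}F_d'x\in\mathbb{R}^{mN_u}$ is the piecewise affine function $$U(x)=\mathcal{F}_{d,i}x+\mathcal{G}_{d,i}\quad\text{if}\quad \mathcal{H}_{d,i}x\le\mathcal{K}_{d,i},\qquad i=1,\dots,M$$ (at least one of the $M$ conditions holds for every such $x$, and the formula is valid for every $i$ whose condition holds), where $$\mathcal{F}_{d,i}=H_d^{-1}\tilde G_{d,i}'(\tilde G_{d,i}H_d^{-1}\tilde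 G_{d,i}')^{-1}\tilde S_{d,i}-H_d^{-1}F_d',$$ $$\mathcal{G}_{d,i}=H_d^{-1}\tilde G_{d,i}'(\tilde G_{d,i}H_d^{-1}\tilde G_{d,i}')^{-1}\tilde W_{d,i},$$ $$\mathcal{H}_{d,i}=\begin{bmatrix}(\tilde G_{d,i}H_d^{-1}\tilde G_{d,i}')^{-1}\tilde S_{d,i}\\ G_dH_d^{-1}\tilde G_{d,i}'(\tilde G_{d,i}H_d^{-1}\tilde G_{d,i}')^{-1}\tilde S_{d,i}-S_d\end{bmatrix},$$ $$\mathcal{K}_{d,i}=\begin{bmatrix}-(\tilde G_{d,i}H_d^{-1}\tilde G_{d,i}')^{-1}\tilde W_{d,i}\\ -G_dH_d^{-1}\tilde G_{d,i}'(\tilde G_{d,i}H_d^{-1}\tilde G_{d,i}')^{-1}\tilde W_{d,i}+W_d\end{bmatrix}.$$ Consequently the data-driven explicit predictive law, i.e. the first $m$ components $u(x)$ of $U(x)$, has the form $u(x)=F_{d,i}x+g_{d,i}$ if $\mathcal{H}_{d,i}x\le\mathcal{K}_{d,i}$, $i=1,\dots,M$, where $F_{d,i}$ and $g_{d,i}$ are the first $m$ rows of $\mathcal{F}_{d,i}$ and $\mathcal{G}_{d,i}$.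
   Context: **Notation.** $'$ denotes transpose, vector inequalities are componentwise, and $D^\dagger$ denotes a right inverse of a full-row-rank matrix $D$. A constraint row is active at a feasible $z$ if it holds with equality. For the empty active set, all terms involving $\tilde G_{d,i},\tilde W_{d,i},\tilde S_{d,i}$ are absent: $\mathcal{F}_{d,i}=-H_d^{-1}F_d'$, $\mathcal{G}_{d,i}=0$, $\mathcal{H}_{d,i}=-S_d$, $\mathcal{K}_{d,i}=W_d$. **Data.** $U_{0,1,T}=[u(0)\ \cdots\ u(T-1)]$, $X_{0,T}=[x(0)\ \cdots\ x(T-1)]$, $X_{1,T}=[x(1)\ \cdots\ x(T)]$. **Design parameters.** Horizons $N_x,N_u,N_c\ge1$ with $N_u\le N_x$, symmetric $Q\succeq0$, $P\succeq0$, $R\succ0$, a gain $K\in\mathbb{R}^{m\times n}$, and constraint data $\mathcal{C}_x,\mathcal{C}_u,d$ of compatible sizes. These come from the optimal control problem of minimizing $x(N_x)'Px(N_x)+\sum_{k=0}^{N_x-1}[x(k)'Qx(k)+u(k)'Ru(k)]$ over $U=(u(0)',\dots,u(N_u-1)')'$, subject to the dynamics, $x(0)=x$, $\mathcal{C}_xx(k)+\mathcal{C}_uu(k)\le d$ for $0\le k\le N_c-1$, and $u(k)=Kx(k)$ for $k\ge N_u$. **Data-based matrices.** Put $$[\gamma_d\ \ \xi_d]=X_{1,T}\begin{bmatrix}U_{0,1,T}\\ X_{0,T}\end{bmatrix}^\dagger,\qquad \gamma_d\in\mathbb{R}^{n\times m},\ \xi_d\in\mathbb{R}^{n\times n}.$$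 Consider the predictions $x_d(0)=x$, $x_d(k+1)=\xi_dx_d(k)+\gamma_du(k)$, where $u(k)$ is the $k$-th block of $U$ for $k<N_u$ and $u(k)=Kx_d(k)$ for $k\ge N_u$. Write $x_d(k)=\Phi_kx+\Psi_kU$ and $u(k)=\Theta_kx+\Lambda_kU$. Define - $H_d=\Psi_{N_x}'P\Psi_{N_x}+\sum_{k=0}^{N_x-1}(\Psi_k'Q\Psi_k+\Lambda_k'R\Lambda_k)$, which is positive definite since $R\succ0$; - $F_d=\Phi_{N_x}'P\Psi_{N_x}+\sum_{k=0}^{N_x-1}(\Phi_k'Q\Psi_k+\Theta_k'R\Lambda_k)$; - $G_d$, $W_d$, $E_d$: the vertical stacking over $k=0,\dots,N_c-1$ of the blocks $\mathcal{C}_x\Psi_k+\mathcal{C}_u\Lambda_k$, of $d$, and of $-(\mathcal{C}_x\Phi_k+\mathcal{C}_u\Theta_k)$, respectively; - $S_d=E_d+G_dH_d^{-1}F_d'$. *)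

theory Defs
  imports
    "Jordan_Normal_Form.DL_Rank"
    "Jordan_Normal_Form.DL_Submatrix"
    "Jordan_Normal_Form.Gauss_Jordan_Elimination"
begin

section \<open>Auxiliary matrix notions\<close>

definition mat_inv :: "'a :: field mat \<Rightarrow> 'a mat" where
  "mat_inv A = the (mat_inverse A)"

definition append_cols :: "'a :: zero mat \<Rightarrow> 'a mat \<Rightarrow> 'a mat" where
  "append_cols A B = four_block_mat A B (0\<^sub>m 0 (dim_col A)) (0\<^sub>m 0 (dim_col B))"

text \<open>
  A right inverse is not unique; every full-row-rank matrix has one, see
  \<open>right_inverse_exists\<close> below.
\<close>

definition right_inverse :: "'a :: semiring_1 mat \<Rightarrow> 'a mat \<Rightarrow> bool" where
  "right_inverse D E \<longleftrightarrow>
     E \<in> carrier_mat (dim_col D) (dim_row D) \<and> D * E = 1\<^sub>m (dim_row D)"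

definition sym_pos_semidef :: "nat \<Rightarrow> real mat \<Rightarrow> bool" where
  "sym_pos_semidef n A \<longleftrightarrow> A \<in> carrier_mat n n \<and> A\<^sup>T = A \<and>
     (\<forall>v \<in> carrier_vec n. 0 \<le> v \<bullet> (A *\<^sub>v v))"

definition sym_pos_def :: "nat \<Rightarrow> real mat \<Rightarrow> bool" where
  "sym_pos_def n A \<longleftrightarrow> A \<in> carrier_mat n n \<and> A\<^sup>T = A \<and>
     (\<forall>v \<in> carrier_vec n. v \<noteq> 0\<^sub>v n \<longrightarrow> 0 < v \<bullet> (A *\<^sub>v v))"

definition lin_indpt_rows :: "'a :: field mat \<Rightarrow> bool" where
  "lin_indpt_rows A \<longleftrightarrow> distinct (rows A) \<and>
     \<not> module.lin_dep class_ring (module_vec TYPE('a) (dim_col A)) (set (rows A))"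

definition mat_sum :: "nat \<Rightarrow> nat \<Rightarrow> (nat \<Rightarrow> 'a :: comm_monoid_add mat) \<Rightarrow> nat set \<Rightarrow> 'a mat" where
  "mat_sum nr nc f S = mat nr nc (\<lambda>(i, j). \<Sum>k\<in>S. f k $$ (i, j))"

definition stack_mats :: "nat \<Rightarrow> nat \<Rightarrow> nat \<Rightarrow> (nat \<Rightarrow> 'a mat) \<Rightarrow> 'a mat" where
  "stack_mats N p nc blk = mat (N * p) nc (\<lambda>(i, j). blk (i div p) $$ (i mod p, j))"

definition stack_vecs :: "nat \<Rightarrow> nat \<Rightarrow> (nat \<Rightarrow> 'a vec) \<Rightarrow> 'a vec" where
  "stack_vecs N p blk = vec (N * p) (\<lambda>i. blk (i div p) $ (i mod p))"

definition subvector :: "'a vec \<Rightarrow> nat set \<Rightarrow> 'a vec" where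
  "subvector v I = vec (card {i. i < dim_vec v \<and> i \<in> I}) (\<lambda>i. v $ pick I i)"

definition select_rows :: "'a mat \<Rightarrow> nat set \<Rightarrow> 'a mat" where
  "select_rows A I = submatrix A I UNIV"

definition first_rows :: "'a mat \<Rightarrow> nat \<Rightarrow> 'a mat" where
  "first_rows A m = mat m (dim_col A) (\<lambda>(i, j). A $$ (i, j))"

lemma mat_inv_empty:
  fixes A :: "'a :: field mat"
  assumes A0: "A \<in> carrier_mat 0 0"
  shows "mat_inv A = 1\<^sub>m 0"
proof -
  have A: "A = 1\<^sub>m 0" using A0 by (intro eq_matI) auto
  have "A \<in> Units (ring_mat TYPE('a) 0 ())"
    unfolding A by (auto simp: Units_def ring_mat_def intro!: bexI[of _ "1\<^sub>m 0"])
  then obtain B where B: "mat_inverse A = Some B"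
    using mat_inverse(1)[OF A0, of "()"] by (cases "mat_inverse A") auto
  then have "B \<in> carrier_mat 0 0" using mat_inverse(2)[OF A0 B] by simp
  then have "B = 1\<^sub>m 0" by (intro eq_matI) auto
  then show ?thesis using B by (simp add: mat_inv_def)
qed

lemma right_inverse_exists:
  fixes D :: "'a :: field mat"
  assumes D: "D \<in> carrier_mat r c" and rank: "vec_space.rank r D = r"
  shows "\<exists>E. right_inverse D E"
proof -
  interpret vec_space "TYPE('a)" r .
  have cols: "set (cols D) \<subseteq> carrier_vec r" using D cols_dim by blast
  obtain B where B: "maximal B (\<lambda>T. T \<subseteq> set (cols D) \<and> lin_indpt T)"
    using maximal_exists[of "\<lambda>T. T \<subseteq> set (cols D) \<and> lin_indpt T" "card (set (cols D))" "{}"]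
    by (meson List.finite_set card_mono empty_iff empty_subsetI finite_lin_indpt2 rev_finite_subset)
  then have B': "B \<subseteq> set (cols D)" "lin_indpt B" by (auto simp: maximal_def)
  have "card B = r" using rank_card_indpt[OF D B] rank by simp
  then have "basis B"
    using B' cols finite_subset[OF B'(1)] dim_is_n by (intro dim_li_is_basis) auto
  then have "carrier_vec r \<subseteq> span (set (cols D))"
    using span_is_monotone[OF B'(1)] by (auto simp: basis_def)
  then have cs: "\<And>y. y \<in> carrier_vec r \<Longrightarrow> \<exists>x\<in>carrier_vec c. D *\<^sub>v x = y"
    using col_space_eq[OF D] D by (auto simp: col_space_def)
  have "\<forall>j. \<exists>x\<in>carrier_vec c. D *\<^sub>v x = unit_vec r j" by (intro allI cs) simp
  then obtain e where e: "\<And>j. e j \<in> carrier_vec c" "\<And>j. D *\<^sub>v e j = unit_vec r j" by metis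
  define E where "E = mat_of_cols c (map e [0..<r])"
  have E: "E \<in> carrier_mat c r" using mat_of_cols_carrier(1)[of c "map e [0..<r]"] by (simp add: E_def)
  have colE: "col E j = e j" if "j < r" for j
    using that e(1) by (simp add: E_def)
  have "D * E = 1\<^sub>m r"
  proof (rule eq_matI)
    fix i j assume ij: "i < dim_row (1\<^sub>m r :: 'a mat)" "j < dim_col (1\<^sub>m r :: 'a mat)"
    then have "(D * E) $$ (i, j) = (D *\<^sub>v e j) $ i" using D E colE by auto
    then show "(D * E) $$ (i, j) = 1\<^sub>m r $$ (i, j)" using e(2) ij by simp
  qed (use D E in auto)
  then show ?thesis using D E by (auto simp: right_inverse_def)
qed


section \<open>Predictions\<close>

definition input_block :: "nat \<Rightarrow> real vec \<Rightarrow> nat \<Rightarrow> real vec" where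
  "input_block m U k = vec m (\<lambda>i. U $ (k * m + i))"

primrec pred_state ::
  "real mat \<Rightarrow> real mat \<Rightarrow> real mat \<Rightarrow> nat \<Rightarrow> real vec \<Rightarrow> real vec \<Rightarrow> nat \<Rightarrow> real vec" where
  "pred_state \<gamma> \<xi> K Nu x U 0 = x"
| "pred_state \<gamma> \<xi> K Nu x U (Suc k) =
     \<xi> *\<^sub>v pred_state \<gamma> \<xi> K Nu x U k +
     \<gamma> *\<^sub>v (if k < Nu then input_block (dim_col \<gamma>) U k else K *\<^sub>v pred_state \<gamma> \<xi> K Nu x U k)"

definition pred_input ::
  "real mat \<Rightarrow> real mat \<Rightarrow> real mat \<Rightarrow> nat \<Rightarrow> real vec \<Rightarrow> real vec \<Rightarrow> nat \<Rightarrow> real vec" where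
  "pred_input \<gamma> \<xi> K Nu x U k =
     (if k < Nu then input_block (dim_col \<gamma>) U k else K *\<^sub>v pred_state \<gamma> \<xi> K Nu x U k)"

definition input_selector :: "nat \<Rightarrow> nat \<Rightarrow> nat \<Rightarrow> real mat" where
  "input_selector m Nu k = mat m (m * Nu) (\<lambda>(i, j). if j = k * m + i then 1 else 0)"

text \<open>
  The coefficient matrices of the predictions; that they represent
  \<^const>\<open>pred_state\<close> and \<^const>\<open>pred_input\<close> is shown in the lemmas
  \<open>pred_state_eq\<close> and \<open>pred_input_eq\<close> below.
\<close>

primrec Phi_mat :: "real mat \<Rightarrow> real mat \<Rightarrow> real mat \<Rightarrow> nat \<Rightarrow> nat \<Rightarrow> real mat" where
  "Phi_mat \<gamma> \<xi> K Nu 0 = 1\<^sub>m (dim_row \<xi>)"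
| "Phi_mat \<gamma> \<xi> K Nu (Suc k) = \<xi> * Phi_mat \<gamma> \<xi> K Nu k +
     \<gamma> * (if k < Nu then 0\<^sub>m (dim_col \<gamma>) (dim_row \<xi>) else K * Phi_mat \<gamma> \<xi> K Nu k)"

primrec Psi_mat :: "real mat \<Rightarrow> real mat \<Rightarrow> real mat \<Rightarrow> nat \<Rightarrow> nat \<Rightarrow> real mat" where
  "Psi_mat \<gamma> \<xi> K Nu 0 = 0\<^sub>m (dim_row \<xi>) (dim_col \<gamma> * Nu)"
| "Psi_mat \<gamma> \<xi> K Nu (Suc k) = \<xi> * Psi_mat \<gamma> \<xi> K Nu k +
     \<gamma> * (if k < Nu then input_selector (dim_col \<gamma>) Nu k else K * Psi_mat \<gamma> \<xi> K Nu k)"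

definition Theta_mat :: "real mat \<Rightarrow> real mat \<Rightarrow> real mat \<Rightarrow> nat \<Rightarrow> nat \<Rightarrow> real mat" where
  "Theta_mat \<gamma> \<xi> K Nu k =
     (if k < Nu then 0\<^sub>m (dim_col \<gamma>) (dim_row \<xi>) else K * Phi_mat \<gamma> \<xi> K Nu k)"

definition Lambda_mat :: "real mat \<Rightarrow> real mat \<Rightarrow> real mat \<Rightarrow> nat \<Rightarrow> nat \<Rightarrow> real mat" where
  "Lambda_mat \<gamma> \<xi> K Nu k =
     (if k < Nu then input_selector (dim_col \<gamma>) Nu k else K * Psi_mat \<gamma> \<xi> K Nu k)"

context
  fixes n m :: nat and \<gamma> \<xi> K :: "real mat" and Nu :: nat
  assumes \<gamma>: "\<gamma> \<in> carrier_mat n m" and \<xi>: "\<xi> \<in> carrier_mat n n" and K: "K \<in> carrier_mat m n"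
begin

lemma Phi_mat_carrier: "Phi_mat \<gamma> \<xi> K Nu k \<in> carrier_mat n n"
  using \<gamma> \<xi> K by (induction k) auto

lemma Psi_mat_carrier: "Psi_mat \<gamma> \<xi> K Nu k \<in> carrier_mat n (m * Nu)"
  using \<gamma> \<xi> K by (induction k) (auto simp: input_selector_def)

lemma Theta_mat_carrier: "Theta_mat \<gamma> \<xi> K Nu k \<in> carrier_mat m n"
  using \<gamma> \<xi> K Phi_mat_carrier[of k] by (auto simp: Theta_mat_def)

lemma Lambda_mat_carrier: "Lambda_mat \<gamma> \<xi> K Nu k \<in> carrier_mat m (m * Nu)"
  using \<gamma> \<xi> K Psi_mat_carrier[of k] by (auto simp: Lambda_mat_def input_selector_def)

lemma input_selector_mult:
  assumes U: "U \<in> carrier_vec (m * Nu)" and k: "k < Nu"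
  shows "input_selector m Nu k *\<^sub>v U = input_block m U k"
proof (rule eq_vecI)
  fix i assume "i < dim_vec (input_block m U k)"
  then have i: "i < m" by (simp add: input_block_def)
  have "k * m + i < Suc k * m" using i by simp
  also have "\<dots> \<le> Nu * m" using k by (intro mult_le_mono1) simp
  finally have lt: "k * m + i < m * Nu" by (simp add: mult.commute)
  have "(input_selector m Nu k *\<^sub>v U) $ i = (\<Sum>j<m * Nu. (if j = k * m + i then 1 else 0) * U $ j)"
    using i U by (auto simp: input_selector_def scalar_prod_def atLeast0LessThan intro!: sum.cong)
  also have "\<dots> = (\<Sum>j<m * Nu. if j = k * m + i then U $ j else 0)"
    by (intro sum.cong) auto
  also have "\<dots> = U $ (k * m + i)" using lt by simp
  finally show "(input_selector m Nu k *\<^sub>v U) $ i = input_block m U k $ i"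
    using i by (simp add: input_block_def)
qed (auto simp: input_selector_def input_block_def)

lemma pred_state_input_eq:
  assumes x: "x \<in> carrier_vec n" and U: "U \<in> carrier_vec (m * Nu)"
  shows "pred_state \<gamma> \<xi> K Nu x U k = Phi_mat \<gamma> \<xi> K Nu k *\<^sub>v x + Psi_mat \<gamma> \<xi> K Nu k *\<^sub>v U
    \<and> pred_input \<gamma> \<xi> K Nu x U k = Theta_mat \<gamma> \<xi> K Nu k *\<^sub>v x + Lambda_mat \<gamma> \<xi> K Nu k *\<^sub>v U"
proof -
  have inp: "pred_input \<gamma> \<xi> K Nu x U k = Theta_mat \<gamma> \<xi> K Nu k *\<^sub>v x + Lambda_mat \<gamma> \<xi> K Nu k *\<^sub>v U"
    if st: "pred_state \<gamma> \<xi> K Nu x U k = Phi_mat \<gamma> \<xi> K Nu k *\<^sub>v x + Psi_mat \<gamma> \<xi> K Nu k *\<^sub>v U" for k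
  proof (cases "k < Nu")
    case True
    moreover have "0\<^sub>m m n *\<^sub>v x = 0\<^sub>v m" using x by (intro eq_vecI) auto
    moreover have "input_block m U k \<in> carrier_vec m" by (simp add: input_block_def)
    ultimately show ?thesis
      using \<gamma> \<xi> input_selector_mult[OF U True]
      by (auto simp: pred_input_def Theta_mat_def Lambda_mat_def)
  next
    case False
    show ?thesis
      using False st mult_add_distrib_mat_vec[OF K
        mult_mat_vec_carrier[OF Phi_mat_carrier[of k] x] mult_mat_vec_carrier[OF Psi_mat_carrier[of k] U]]
      by (simp add: pred_input_def Theta_mat_def Lambda_mat_def
        assoc_mult_mat_vec[OF K Phi_mat_carrier x] assoc_mult_mat_vec[OF K Psi_mat_carrier U])
  qed
  have st: "pred_state \<gamma> \<xi> K Nu x U k = Phi_mat \<gamma> \<xi> K Nu k *\<^sub>v x + Psi_mat \<gamma> \<xi> K Nu k *\<^sub>v U"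
  proof (induction k)
    case 0
    have "0\<^sub>m n (m * Nu) *\<^sub>v U = 0\<^sub>v n" using U by (intro eq_vecI) auto
    then show ?case using \<gamma> \<xi> x by auto
  next
    case (Suc k)
    let ?\<Phi> = "Phi_mat \<gamma> \<xi> K Nu k" and ?\<Psi> = "Psi_mat \<gamma> \<xi> K Nu k"
    let ?\<Theta> = "Theta_mat \<gamma> \<xi> K Nu k" and ?\<Lambda> = "Lambda_mat \<gamma> \<xi> K Nu k"
    note c = Phi_mat_carrier[of k] Psi_mat_carrier[of k] Theta_mat_carrier[of k] Lambda_mat_carrier[of k]
    note v = mult_mat_vec_carrier[OF c(1) x] mult_mat_vec_carrier[OF c(2) U]
      mult_mat_vec_carrier[OF c(3) x] mult_mat_vec_carrier[OF c(4) U]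
    have "pred_state \<gamma> \<xi> K Nu x U (Suc k) =
        \<xi> *\<^sub>v (?\<Phi> *\<^sub>v x + ?\<Psi> *\<^sub>v U) + \<gamma> *\<^sub>v (?\<Theta> *\<^sub>v x + ?\<Lambda> *\<^sub>v U)"
      using Suc.IH inp[OF Suc.IH] by (simp add: pred_input_def)
    also have "\<dots> = (\<xi> *\<^sub>v (?\<Phi> *\<^sub>v x) + \<xi> *\<^sub>v (?\<Psi> *\<^sub>v U)) + (\<gamma> *\<^sub>v (?\<Theta> *\<^sub>v x) + \<gamma> *\<^sub>v (?\<Lambda> *\<^sub>v U))"
      by (simp add: mult_add_distrib_mat_vec[OF \<xi> v(1,2)] mult_add_distrib_mat_vec[OF \<gamma> v(3,4)])
    also have "\<dots> = (\<xi> *\<^sub>v (?\<Phi> *\<^sub>v x) + \<gamma> *\<^sub>v (?\<Theta> *\<^sub>v x)) + (\<xi> *\<^sub>v (?\<Psi> *\<^sub>v U) + \<gamma> *\<^sub>v (?\<Lambda> *\<^sub>v U))"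
      using \<gamma> \<xi> by (intro eq_vecI) auto
    also have "\<dots> = (\<xi> * ?\<Phi> + \<gamma> * ?\<Theta>) *\<^sub>v x + (\<xi> * ?\<Psi> + \<gamma> * ?\<Lambda>) *\<^sub>v U"
      by (simp add: add_mult_distrib_mat_vec[OF mult_carrier_mat[OF \<xi> c(1)] mult_carrier_mat[OF \<gamma> c(3)] x]
        add_mult_distrib_mat_vec[OF mult_carrier_mat[OF \<xi> c(2)] mult_carrier_mat[OF \<gamma> c(4)] U]
        assoc_mult_mat_vec[OF \<xi> c(1) x] assoc_mult_mat_vec[OF \<gamma> c(3) x]
        assoc_mult_mat_vec[OF \<xi> c(2) U] assoc_mult_mat_vec[OF \<gamma> c(4) U])
    finally show ?case by (simp add: Theta_mat_def Lambda_mat_def)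
  qed
  show ?thesis using st inp[OF st] by blast
qed

lemmas pred_state_eq = pred_state_input_eq[THEN conjunct1]
lemmas pred_input_eq = pred_state_input_eq[THEN conjunct2]

end


section \<open>Condensed optimal control problem\<close>

definition cost_H where
  "cost_H \<gamma> \<xi> K Nu Nx P Q R =
     (let \<Psi> = Psi_mat \<gamma> \<xi> K Nu; \<Lambda> = Lambda_mat \<gamma> \<xi> K Nu; N = dim_col \<gamma> * Nu in
      (\<Psi> Nx)\<^sup>T * P * \<Psi> Nx +
      mat_sum N N (\<lambda>k. (\<Psi> k)\<^sup>T * Q * \<Psi> k + (\<Lambda> k)\<^sup>T * R * \<Lambda> k) {..<Nx})"

definition cost_F where
  "cost_F \<gamma> \<xi> K Nu Nx P Q R =
     (let \<Phi> = Phi_mat \<gamma> \<xi> K Nu; \<Psi> = Psi_mat \<gamma> \<xi> K Nu;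
          \<Theta> = Theta_mat \<gamma> \<xi> K Nu; \<Lambda> = Lambda_mat \<gamma> \<xi> K Nu in
      (\<Phi> Nx)\<^sup>T * P * \<Psi> Nx +
      mat_sum (dim_row \<xi>) (dim_col \<gamma> * Nu)
        (\<lambda>k. (\<Phi> k)\<^sup>T * Q * \<Psi> k + (\<Theta> k)\<^sup>T * R * \<Lambda> k) {..<Nx})"

definition constr_G where
  "constr_G \<gamma> \<xi> K Nu Nc Cx Cu = stack_mats Nc (dim_row Cx) (dim_col \<gamma> * Nu)
     (\<lambda>k. Cx * Psi_mat \<gamma> \<xi> K Nu k + Cu * Lambda_mat \<gamma> \<xi> K Nu k)"

definition constr_W :: "nat \<Rightarrow> real vec \<Rightarrow> real vec" where
  "constr_W Nc d = stack_vecs Nc (dim_vec d) (\<lambda>k. d)"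

definition constr_E where
  "constr_E \<gamma> \<xi> K Nu Nc Cx Cu = stack_mats Nc (dim_row Cx) (dim_row \<xi>)
     (\<lambda>k. - (Cx * Phi_mat \<gamma> \<xi> K Nu k + Cu * Theta_mat \<gamma> \<xi> K Nu k))"

definition constr_S :: "real mat \<Rightarrow> real mat \<Rightarrow> real mat \<Rightarrow> real mat \<Rightarrow> real mat" where
  "constr_S H F G E = E + G * mat_inv H * F\<^sup>T"


section \<open>The parametric quadratic program\<close>

definition qp_feasible :: "real mat \<Rightarrow> real vec \<Rightarrow> real mat \<Rightarrow> real vec \<Rightarrow> real vec \<Rightarrow> bool" where
  "qp_feasible G W S x z \<longleftrightarrow> z \<in> carrier_vec (dim_col G) \<and> G *\<^sub>v z \<le> W + S *\<^sub>v x"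

definition qp_solution ::
  "real mat \<Rightarrow> real mat \<Rightarrow> real vec \<Rightarrow> real mat \<Rightarrow> real vec \<Rightarrow> real vec \<Rightarrow> bool" where
  "qp_solution H G W S x z \<longleftrightarrow> qp_feasible G W S x z \<and>
     (\<forall>y. qp_feasible G W S x y \<longrightarrow> z \<bullet> (H *\<^sub>v z) \<le> y \<bullet> (H *\<^sub>v y))"

definition active_set :: "real mat \<Rightarrow> real vec \<Rightarrow> real mat \<Rightarrow> real vec \<Rightarrow> real vec \<Rightarrow> nat set" where
  "active_set G W S x z = {j. j < dim_row G \<and> (G *\<^sub>v z) $ j = (W + S *\<^sub>v x) $ j}"

definition optimal_active_sets ::
  "real mat \<Rightarrow> real mat \<Rightarrow> real vec \<Rightarrow> real mat \<Rightarrow> nat set set" where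
  "optimal_active_sets H G W S =
     {active_set G W S x z | x z. x \<in> carrier_vec (dim_col S) \<and> qp_solution H G W S x z}"


section \<open>The explicit law\<close>

text \<open>
  The argument \<open>I\<close> is the set of active row indices.  For \<open>I = {}\<close> the selected matrices have no
  rows, so all products through them are zero or void; see the lemmas \<open>law_F_empty\<close> to \<open>region_K_empty\<close> below.
\<close>

definition kkt_inv :: "real mat \<Rightarrow> real mat \<Rightarrow> nat set \<Rightarrow> real mat" where
  "kkt_inv H G I = mat_inv (select_rows G I * mat_inv H * (select_rows G I)\<^sup>T)"

definition law_F :: "real mat \<Rightarrow> real mat \<Rightarrow> real mat \<Rightarrow> real mat \<Rightarrow> nat set \<Rightarrow> real mat" where
  "law_F H F G S I =
     mat_inv H * (select_rows G I)\<^sup>T * kkt_inv H G I * select_rows S I - mat_inv H * F\<^sup>T"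

definition law_G :: "real mat \<Rightarrow> real mat \<Rightarrow> real vec \<Rightarrow> nat set \<Rightarrow> real vec" where
  "law_G H G W I = (mat_inv H * (select_rows G I)\<^sup>T * kkt_inv H G I) *\<^sub>v subvector W I"

definition region_H :: "real mat \<Rightarrow> real mat \<Rightarrow> real mat \<Rightarrow> nat set \<Rightarrow> real mat" where
  "region_H H G S I =
     (kkt_inv H G I * select_rows S I) @\<^sub>r
     (G * mat_inv H * (select_rows G I)\<^sup>T * kkt_inv H G I * select_rows S I - S)"

definition region_K :: "real mat \<Rightarrow> real mat \<Rightarrow> real vec \<Rightarrow> nat set \<Rightarrow> real vec" where
  "region_K H G W I =
     (- (kkt_inv H G I *\<^sub>v subvector W I)) @\<^sub>v
     (- ((G * mat_inv H * (select_rows G I)\<^sup>T * kkt_inv H G I) *\<^sub>v subvector W I) + W)"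

lemma select_rows_empty:
  "A \<in> carrier_mat q k \<Longrightarrow> select_rows A {} \<in> carrier_mat 0 k" "subvector w {} = 0\<^sub>v 0"
  by (auto simp: select_rows_def dim_submatrix subvector_def)

context
  fixes n N q :: nat and H F G S :: "real mat" and W :: "real vec"
  assumes inv: "mat_inv H \<in> carrier_mat N N" and F: "F \<in> carrier_mat n N"
    and G: "G \<in> carrier_mat q N" and S: "S \<in> carrier_mat q n" and W: "W \<in> carrier_vec q"
begin

lemma kkt_inv_empty: "kkt_inv H G {} = 1\<^sub>m 0"
  unfolding kkt_inv_def using inv select_rows_empty(1)[OF G] by (intro mat_inv_empty) auto

lemma law_F_empty: "law_F H F G S {} = - (mat_inv H * F\<^sup>T)"
  unfolding law_F_def kkt_inv_empty
  using inv F select_rows_empty(1)[OF G] select_rows_empty(1)[OF S]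
  by (intro eq_matI) (auto simp: scalar_prod_def)

lemma law_G_empty: "law_G H G W {} = 0\<^sub>v N"
  unfolding law_G_def kkt_inv_empty
  using inv select_rows_empty(1)[OF G] select_rows_empty(2)[of W]
  by (intro eq_vecI) (auto simp: scalar_prod_def)

lemma region_H_empty: "region_H H G S {} = - S"
  unfolding region_H_def kkt_inv_empty append_rows_def
  using inv G S select_rows_empty(1)[OF G] select_rows_empty(1)[OF S]
  by (intro eq_matI) (auto simp: scalar_prod_def)

lemma region_K_empty: "region_K H G W {} = W"
  unfolding region_K_def kkt_inv_empty
  using inv G W select_rows_empty(1)[OF G] select_rows_empty(2)[of W]
  by (intro eq_vecI) (auto simp: scalar_prod_def)

end

end

(*
  Existence and uniqueness of the minimizer follow from strict convexity of the form of H: a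
  minimizing sequence is Cauchy by the parallelogram law.  If the active rows A at the optimum are
  independent, A H^-1 A^T is positive definite, and the point
  H^-1 A^T (A H^-1 A^T)^-1 c is the only one with A z = c whose H-gradient lies in the row space of A.
  Testing feasible directions identifies the optimum with this point, with c the active part of
  W + S x, and shows the multipliers to have the right sign; conversely, nonpositivity of
  (A H^-1 A^T)^-1 c and feasibility, which together make up the region inequality, are sufficient
  for optimality.
*)

theory Submission
  imports Defs
begin

text \<open>The parameter \<open>x\<close> enters the program only through the right-hand side
  \<open>b = W + S x\<close>, so optimality is studied for fixed \<open>b\<close>; \<open>x\<close>
  returns at the end because the selected part of \<open>b\<close> is affine in \<open>x\<close>.
  The delicate claim is that the formula is valid on every region containing \<open>x\<close>:
  regions may overlap, and the index set of a region may be smaller than the active set at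
  \<open>x\<close>. Hence sufficiency is proved for an arbitrary index set with independent rows,
  and uniqueness of the minimizer makes all the formulas agree. For necessity no theorem of
  alternatives is invoked: independence makes the active rows surjective, so each multiplier can be
  tested separately. The sign \<open><= 0\<close> comes from stationarity of
  \<open>z' H z + l' (A z - c)\<close>, which gives \<open>l = -2 (A H^-1 A')^-1 c\<close> and so
  reverses the usual \<open>l >= 0\<close>. The empty index set is no separate case, since matrices
  without rows obey the same lemmas.\<close>

section \<open>Positive definite quadratic forms\<close>

context
  fixes N :: nat and H :: "real mat"
  assumes pd: "sym_pos_def N H"
begin

lemma pos_def_carrier: "H \<in> carrier_mat N N"
  using pd by (simp add: sym_pos_def_def)

lemma pos_def_form_sym:
  assumes u: "u \<in> carrier_vec N" and v: "v \<in> carrier_vec N"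
  shows "u \<bullet> (H *\<^sub>v v) = v \<bullet> (H *\<^sub>v u)"
proof -
  have "H\<^sup>T = H" using pd by (simp add: sym_pos_def_def)
  then have "(H *\<^sub>v u) \<bullet> v = u \<bullet> (H *\<^sub>v v)"
    using transpose_vec_mult_scalar[OF pos_def_carrier v u] by simp
  then show ?thesis
    using comm_scalar_prod[OF mult_mat_vec_carrier[OF pos_def_carrier u] v] by simp
qed

lemma pos_def_form_nonneg: "v \<in> carrier_vec N \<Longrightarrow> 0 \<le> v \<bullet> (H *\<^sub>v v)"
  using pd pos_def_carrier by (cases "v = 0\<^sub>v N") (auto simp: sym_pos_def_def less_imp_le)

lemma pos_def_form_eq_0: "v \<in> carrier_vec N \<Longrightarrow> v \<bullet> (H *\<^sub>v v) \<le> 0 \<Longrightarrow> v = 0\<^sub>v N"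
  using pd by (force simp: sym_pos_def_def)

text \<open>The scalar \<open>t\<close> is kept free because this one expansion serves as the
  discriminant argument for Cauchy-Schwarz, as the parallelogram law (\<open>t\<close> equal to 1/2
  and -1/2), as a one-sided derivative (small positive \<open>t\<close>), and as the comparison of
  two feasible points (\<open>t = 1\<close>).\<close>

lemma pos_def_form_expand:
  assumes u: "u \<in> carrier_vec N" and v: "v \<in> carrier_vec N"
  shows "(u + t \<cdot>\<^sub>v v) \<bullet> (H *\<^sub>v (u + t \<cdot>\<^sub>v v)) =
    u \<bullet> (H *\<^sub>v u) + 2 * t * (u \<bullet> (H *\<^sub>v v)) + t\<^sup>2 * (v \<bullet> (H *\<^sub>v v))"
proof -
  note Hc = pos_def_carrier
  have tv: "t \<cdot>\<^sub>v v \<in> carrier_vec N" using v by simp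
  note c = mult_mat_vec_carrier[OF Hc u] mult_mat_vec_carrier[OF Hc v]
  have "H *\<^sub>v (u + t \<cdot>\<^sub>v v) = H *\<^sub>v u + t \<cdot>\<^sub>v (H *\<^sub>v v)"
    by (simp add: mult_add_distrib_mat_vec[OF Hc u tv] mult_mat_vec[OF Hc v])
  then show ?thesis
    using c u v tv pos_def_form_sym[OF u v]
    by (simp add: add_scalar_prod_distrib[of _ N] scalar_prod_add_distrib[of _ N]
        power2_eq_square algebra_simps)
qed

lemma pos_def_cauchy_schwarz:
  assumes u: "u \<in> carrier_vec N" and v: "v \<in> carrier_vec N"
  shows "(u \<bullet> (H *\<^sub>v v))\<^sup>2 \<le> (u \<bullet> (H *\<^sub>v u)) * (v \<bullet> (H *\<^sub>v v))"
proof (cases "v = 0\<^sub>v N")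
  case True
  then have "H *\<^sub>v v = 0\<^sub>v N" using pos_def_carrier by (intro eq_vecI) auto
  then show ?thesis using u v by simp
next
  case False
  then have b: "0 < v \<bullet> (H *\<^sub>v v)" using pd v by (simp add: sym_pos_def_def)
  \<comment> \<open>The minimizer of the expansion as a quadratic in \<open>t\<close>; nonnegativity
    of its minimum is the inequality.\<close>
  define t where "t = - (u \<bullet> (H *\<^sub>v v)) / (v \<bullet> (H *\<^sub>v v))"
  have "0 \<le> u \<bullet> (H *\<^sub>v u) + 2 * t * (u \<bullet> (H *\<^sub>v v)) + t\<^sup>2 * (v \<bullet> (H *\<^sub>v v))"
    using pos_def_form_nonneg[of "u + t \<cdot>\<^sub>v v"] pos_def_form_expand[OF u v] u v by simp
  also have "\<dots> = u \<bullet> (H *\<^sub>v u) - (u \<bullet> (H *\<^sub>v v))\<^sup>2 / (v \<bullet> (H *\<^sub>v v))"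
    using b by (simp add: t_def power2_eq_square field_simps)
  finally show ?thesis using b by (simp add: field_simps)
qed

text \<open>A nonzero kernel vector would make the form vanish, so the determinant is nonzero. Only
  then does the \<open>the\<close> in \<open>mat_inv\<close> yield an actual inverse.\<close>

lemma pos_def_mat_inv:
  "mat_inv H \<in> carrier_mat N N" "H * mat_inv H = 1\<^sub>m N" "mat_inv H * H = 1\<^sub>m N"
proof -
  have det: "det H \<noteq> 0"
  proof
    assume "det H = 0"
    then obtain v where "v \<in> carrier_vec N" "v \<noteq> 0\<^sub>v N" "H *\<^sub>v v = 0\<^sub>v N"
      using det_0_iff_vec_prod_zero[OF pos_def_carrier] by blast
    then show False using pos_def_form_eq_0[of v] by simp
  qed
  have "H \<in> Units (ring_mat TYPE(real) N ())"
    by (rule det_non_zero_imp_unit[OF pos_def_carrier det])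
  then obtain J where J: "mat_inverse H = Some J"
    using mat_inverse(1)[OF pos_def_carrier, of "()"] by (cases "mat_inverse H") auto
  then show "mat_inv H \<in> carrier_mat N N" "H * mat_inv H = 1\<^sub>m N" "mat_inv H * H = 1\<^sub>m N"
    using mat_inverse(2)[OF pos_def_carrier J] by (simp_all add: mat_inv_def)
qed

lemma pos_def_mat_inv_vec:
  assumes v: "v \<in> carrier_vec N"
  shows "mat_inv H *\<^sub>v v \<in> carrier_vec N" "H *\<^sub>v (mat_inv H *\<^sub>v v) = v"
proof -
  show "mat_inv H *\<^sub>v v \<in> carrier_vec N"
    using mult_mat_vec_carrier[OF pos_def_mat_inv(1) v] .
  show "H *\<^sub>v (mat_inv H *\<^sub>v v) = v"
    using assoc_mult_mat_vec[OF pos_def_carrier pos_def_mat_inv(1) v] v pos_def_mat_inv(2) by simp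
qed

text \<open>The transpose of the inverse is a left inverse of \<open>H\<close>, which gives
  symmetry; the form of the inverse at \<open>H w\<close> equals the form of \<open>H\<close> at
  \<open>w\<close>, which gives positivity.\<close>

lemma pos_def_mat_inv_sym_pos_def: "sym_pos_def N (mat_inv H)"
  unfolding sym_pos_def_def
proof (intro conjI ballI impI)
  let ?J = "mat_inv H"
  note J = pos_def_mat_inv
  show "?J \<in> carrier_mat N N" by (rule J)
  have HT: "H\<^sup>T = H" using pd by (simp add: sym_pos_def_def)
  have "?J\<^sup>T * H = (H * ?J)\<^sup>T"
    using transpose_mult[OF pos_def_carrier J(1)] HT by simp
  then have TH: "?J\<^sup>T * H = 1\<^sub>m N" by (simp add: J(2))
  have "?J\<^sup>T = ?J\<^sup>T * (H * ?J)" using J by simp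
  also have "\<dots> = ?J\<^sup>T * H * ?J"
    using assoc_mult_mat[of "?J\<^sup>T" N N H N ?J N] J(1) pos_def_carrier by simp
  also have "\<dots> = ?J" using TH J(1) by simp
  finally show "?J\<^sup>T = ?J" .
  fix v :: "real vec" assume v: "v \<in> carrier_vec N" "v \<noteq> 0\<^sub>v N"
  define w where "w = ?J *\<^sub>v v"
  have w: "w \<in> carrier_vec N" "H *\<^sub>v w = v" using pos_def_mat_inv_vec[OF v(1)] by (simp_all add: w_def)
  then have "w \<noteq> 0\<^sub>v N" using v pos_def_carrier by auto
  then have "0 < w \<bullet> (H *\<^sub>v w)" using pd w(1) unfolding sym_pos_def_def by blast
  then show "0 < v \<bullet> (?J *\<^sub>v v)"
    using w comm_scalar_prod[OF v(1) w(1)] by (simp add: w_def)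
qed

text \<open>The form at \<open>v\<close> is the form of \<open>mat_inv H\<close> at
  \<open>A\<^sup>T v\<close>, and independence of the rows of \<open>A\<close> keeps that vector
  nonzero.\<close>

lemma pos_def_gram:
  assumes A: "A \<in> carrier_mat k N" and li: "lin_indpt_rows A"
  shows "sym_pos_def k (A * mat_inv H * A\<^sup>T)"
  unfolding sym_pos_def_def
proof (intro conjI ballI impI)
  let ?J = "mat_inv H"
  have J: "?J \<in> carrier_mat N N" "?J\<^sup>T = ?J"
    using pos_def_mat_inv_sym_pos_def by (simp_all add: sym_pos_def_def)
  show "A * ?J * A\<^sup>T \<in> carrier_mat k k" using A J by simp
  have "(A * ?J * A\<^sup>T)\<^sup>T = A * (A * ?J)\<^sup>T"
    using transpose_mult[of "A * ?J" k N "A\<^sup>T" k] A J by simp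
  also have "(A * ?J)\<^sup>T = ?J * A\<^sup>T" using transpose_mult[OF A J(1)] J(2) by simp
  also have "A * (?J * A\<^sup>T) = A * ?J * A\<^sup>T"
    using assoc_mult_mat[of A k N ?J N "A\<^sup>T" k] A J by simp
  finally show "(A * ?J * A\<^sup>T)\<^sup>T = A * ?J * A\<^sup>T" .
  fix v :: "real vec" assume v: "v \<in> carrier_vec k" "v \<noteq> 0\<^sub>v k"
  have AT: "A\<^sup>T \<in> carrier_mat N k" using A by simp
  have w: "A\<^sup>T *\<^sub>v v \<in> carrier_vec N" using AT v by simp
  have "A\<^sup>T *\<^sub>v v \<noteq> 0\<^sub>v N"
    using vec_space.lin_depI[OF AT v] li A by (auto simp: lin_indpt_rows_def)
  then have "0 < (A\<^sup>T *\<^sub>v v) \<bullet> (?J *\<^sub>v (A\<^sup>T *\<^sub>v v))"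
    using pos_def_mat_inv_sym_pos_def w by (simp add: sym_pos_def_def)
  also have "\<dots> = v \<bullet> (A *\<^sub>v (?J *\<^sub>v (A\<^sup>T *\<^sub>v v)))"
    using transpose_vec_mult_scalar[OF A mult_mat_vec_carrier[OF J(1) w] v(1)] .
  also have "A *\<^sub>v (?J *\<^sub>v (A\<^sup>T *\<^sub>v v)) = A * ?J * A\<^sup>T *\<^sub>v v"
    using assoc_mult_mat_vec[OF mult_carrier_mat[OF A J(1)] AT v(1)]
      assoc_mult_mat_vec[OF A J(1) w] by simp
  finally show "0 < v \<bullet> (A * ?J * A\<^sup>T *\<^sub>v v)" .
qed

text \<open>The component \<open>v $ i\<close> is the \<open>H\<close>-inner product of
  \<open>v\<close> with \<open>g = H^-1 e_i\<close>, so Cauchy-Schwarz applies; the constant is the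
  \<open>i\<close>-th diagonal entry of \<open>H^-1\<close>.\<close>

lemma pos_def_component_bound:
  assumes i: "i < N"
  shows "\<exists>c\<ge>0. \<forall>v\<in>carrier_vec N. (v $ i)\<^sup>2 \<le> c * (v \<bullet> (H *\<^sub>v v))"
proof -
  define g where "g = mat_inv H *\<^sub>v unit_vec N i"
  have g: "g \<in> carrier_vec N" "H *\<^sub>v g = unit_vec N i"
    using pos_def_mat_inv_vec[of "unit_vec N i"] by (simp_all add: g_def)
  have "(v $ i)\<^sup>2 \<le> (g \<bullet> (H *\<^sub>v g)) * (v \<bullet> (H *\<^sub>v v))" if v: "v \<in> carrier_vec N" for v
  proof -
    have "g \<bullet> (H *\<^sub>v v) = v $ i" using pos_def_form_sym[OF g(1) v] g(2) v i by simp
    then show ?thesis using pos_def_cauchy_schwarz[OF g(1) v] by simp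
  qed
  then show ?thesis using pos_def_form_nonneg[OF g(1)] by blast
qed

lemma pos_def_form_tendsto:
  fixes y :: "nat \<Rightarrow> real vec"
  assumes y: "\<And>k. y k \<in> carrier_vec N" and z: "z \<in> carrier_vec N"
    and lim: "\<And>i. i < N \<Longrightarrow> (\<lambda>k. y k $ i) \<longlonglongrightarrow> z $ i"
  shows "(\<lambda>k. y k \<bullet> (H *\<^sub>v y k)) \<longlonglongrightarrow> z \<bullet> (H *\<^sub>v z)"
proof -
  have *: "v \<bullet> (H *\<^sub>v v) = (\<Sum>i<N. v $ i * (\<Sum>j<N. H $$ (i, j) * v $ j))"
    if "v \<in> carrier_vec N" for v
    using that pos_def_carrier by (auto simp: scalar_prod_def atLeast0LessThan intro!: sum.cong)
  show ?thesis unfolding *[OF z] *[OF y]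
    by (intro tendsto_intros lim) auto
qed

text \<open>
  Along a minimizing sequence the parallelogram law and midpoint convexity force the form of the
  differences to zero; \<open>pos_def_component_bound\<close> then makes every component a Cauchy sequence.
\<close>

lemma pos_def_minimizer_exists:
  assumes ne: "C \<noteq> {}" and C: "C \<subseteq> carrier_vec N"
    and mid: "\<And>u v. u \<in> C \<Longrightarrow> v \<in> C \<Longrightarrow> (1/2) \<cdot>\<^sub>v (u + v) \<in> C"
    and closed: "\<And>y z. (\<And>k. y k \<in> C) \<Longrightarrow> z \<in> carrier_vec N \<Longrightarrow>
      (\<And>i. i < N \<Longrightarrow> (\<lambda>k::nat. y k $ i) \<longlonglongrightarrow> z $ i) \<Longrightarrow> z \<in> C"
  shows "\<exists>z\<in>C. \<forall>y\<in>C. z \<bullet> (H *\<^sub>v z) \<le> y \<bullet> (H *\<^sub>v y)"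
proof -
  define q where "q v = v \<bullet> (H *\<^sub>v v)" for v
  define L where "L = Inf (q ` C)"
  have bdd: "bdd_below (q ` C)"
    using pos_def_form_nonneg C by (auto simp: q_def intro!: bdd_belowI2[of _ 0])
  have Lle: "L \<le> q v" if "v \<in> C" for v
    using that bdd by (auto simp: L_def intro: cInf_lower)
  have "\<exists>v\<in>C. q v < L + 1 / real (Suc k)" for k
  proof -
    have "Inf (q ` C) < L + 1 / real (Suc k)" by (simp add: L_def)
    then show ?thesis using cInf_lessD[of "q ` C"] ne by blast
  qed
  then obtain y where yC: "\<And>k. y k \<in> C" and yL: "\<And>k. q (y k) < L + 1 / real (Suc k)" by metis
  have y: "y k \<in> carrier_vec N" for k using yC C by blast
  \<comment> \<open>With \<open>?m\<close> the midpoint and \<open>?d\<close> the difference,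
    \<open>q ?d = 2 (q (y k) + q (y l)) - 4 q ?m\<close>. The midpoint lies in \<open>C\<close>, so
    \<open>q ?m\<close> is at least \<open>L\<close>, and the multiples of \<open>L\<close>
    cancel.\<close>
  have diff: "q (y k - y l) \<le> 2 / real (Suc k) + 2 / real (Suc l)" for k l
  proof -
    let ?m = "(1/2) \<cdot>\<^sub>v (y k + y l)" and ?d = "y k - y l"
    have m: "?m \<in> carrier_vec N" and d: "?d \<in> carrier_vec N" using y[of k] y[of l] by auto
    have "y k = ?m + (1/2) \<cdot>\<^sub>v ?d" "y l = ?m + (-1/2) \<cdot>\<^sub>v ?d"
      using y[of k] y[of l] by (auto intro!: eq_vecI simp: field_simps)
    then have "q (y k) + q (y l) = 2 * q ?m + q ?d / 2"
      using pos_def_form_expand[OF m d, of "1/2"] pos_def_form_expand[OF m d, of "-1/2"]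
      unfolding q_def by (simp add: power2_eq_square)
    then show ?thesis using Lle[OF mid[OF yC yC]] yL[of k] yL[of l]
      by (smt (verit) add_divide_distrib field_sum_of_halves mult_2 add.commute)
  qed
  have "Cauchy (\<lambda>k. y k $ i)" if i: "i < N" for i
  proof (rule metric_CauchyI)
    fix e :: real assume e: "0 < e"
    obtain c where c: "c \<ge> 0" "\<And>v. v \<in> carrier_vec N \<Longrightarrow> (v $ i)\<^sup>2 \<le> c * q v"
      using pos_def_component_bound[OF i] unfolding q_def by blast
    \<comment> \<open>Beyond \<open>M\<close> the form of a difference is at most
      \<open>4 / M\<close>, so the squared component is at most \<open>4 c / M\<close>, which is
      below \<open>e\<^sup>2\<close>. Using \<open>c + 1\<close> keeps \<open>M\<close> positive
      when \<open>c = 0\<close>.\<close>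
    obtain M :: nat where M: "4 * (c + 1) / e\<^sup>2 < real M" using reals_Archimedean2 by blast
    have "dist (y k $ i) (y l $ i) < e" if "k \<ge> M" "l \<ge> M" for k l
    proof -
      have "0 < 4 * (c + 1) / e\<^sup>2" using c e by simp
      then have Mp: "real M > 0" using M by linarith
      have "q (y k - y l) \<le> 2 / real M + 2 / real M"
        using diff[of k l] that Mp
          frac_le[of 2 2 "real M" "real (Suc k)"] frac_le[of 2 2 "real M" "real (Suc l)"] by simp
      then have "c * q (y k - y l) \<le> c * (4 / real M)" using c(1) by (intro mult_left_mono) auto
      also have "\<dots> < e\<^sup>2" using M Mp e c(1) by (simp add: field_simps)
      finally have "((y k - y l) $ i)\<^sup>2 < e\<^sup>2" using c(2)[of "y k - y l"] y[of k] y[of l] by simp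
      then have "\<bar>(y k - y l) $ i\<bar> < e" using e power2_less_imp_less[of "\<bar>(y k - y l) $ i\<bar>" e] by simp
      then show ?thesis using y[of k] y[of l] i by (simp add: dist_real_def)
    qed
    then show "\<exists>M. \<forall>k\<ge>M. \<forall>l\<ge>M. dist (y k $ i) (y l $ i) < e" by blast
  qed
  then have "\<forall>i. i < N \<longrightarrow> (\<exists>a. (\<lambda>k. y k $ i) \<longlonglongrightarrow> a)"
    using Cauchy_convergent convergent_def by blast
  then obtain a where a: "\<And>i. i < N \<Longrightarrow> (\<lambda>k. y k $ i) \<longlonglongrightarrow> a i" by metis
  define z where "z = vec N a"
  have z: "z \<in> carrier_vec N" "\<And>i. i < N \<Longrightarrow> (\<lambda>k. y k $ i) \<longlonglongrightarrow> z $ i"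
    using a by (auto simp: z_def)
  have "(\<lambda>k. q (y k)) \<longlonglongrightarrow> q z" unfolding q_def by (intro pos_def_form_tendsto y z)
  moreover have "(\<lambda>k. L + 1 / real (Suc k)) \<longlonglongrightarrow> L + 0"
    by (intro tendsto_add tendsto_const LIMSEQ_Suc lim_1_over_n)
  ultimately have "q z \<le> L"
    using LIMSEQ_le[of "\<lambda>k. q (y k)" "q z" "\<lambda>k. L + 1 / real (Suc k)" "L + 0"] yL less_imp_le by auto
  then show ?thesis using closed[OF yC z] Lle unfolding q_def by force
qed

end

section \<open>Selected rows\<close>

lemma card_rows: "I \<subseteq> {..<q} \<Longrightarrow> card {i. i < q \<and> i \<in> I} = card I"
  by (rule arg_cong[of _ _ card]) auto

text \<open>An element \<open>j\<close> sits at the position given by the number of smaller elements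
  of \<open>I\<close>, which is below \<open>card I\<close> because \<open>j\<close> is not counted.
  This translates a condition on the active indices into one on the rows of the selected
  matrix.\<close>

lemma pick_range:
  assumes "I \<subseteq> {..<q::nat}"
  shows "pick I ` {..<card I} = I"
proof
  show "pick I ` {..<card I} \<subseteq> I" using pick_in_set by blast
  show "I \<subseteq> pick I ` {..<card I}"
  proof
    fix j assume j: "j \<in> I"
    have "{a \<in> I. a < j} \<subset> I" using j by auto
    then have "card {a \<in> I. a < j} < card I"
      using assms finite_subset by (intro psubset_card_mono) auto
    then show "j \<in> pick I ` {..<card I}"
      by (intro image_eqI[of _ _ "card {a \<in> I. a < j}"]) (simp_all add: pick_card_in_set[OF j])
  qed
qed

context
  fixes q :: nat and I :: "nat set"
  assumes I: "I \<subseteq> {..<q}"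
begin

lemma pick_less: "r < card I \<Longrightarrow> pick I r < q"
  using I pick_in_set by blast

lemma select_rows_carrier: "A \<in> carrier_mat q N \<Longrightarrow> select_rows A I \<in> carrier_mat (card I) N"
  using card_rows[OF I] by (auto simp: select_rows_def dim_submatrix)

lemma subvector_carrier: "v \<in> carrier_vec q \<Longrightarrow> subvector v I \<in> carrier_vec (card I)"
  using card_rows[OF I] by (auto simp: subvector_def)

lemma subvector_index: "v \<in> carrier_vec q \<Longrightarrow> r < card I \<Longrightarrow> subvector v I $ r = v $ pick I r"
  using card_rows[OF I] by (auto simp: subvector_def)

lemma subvector_add:
  assumes "u \<in> carrier_vec q" "v \<in> carrier_vec q"
  shows "subvector (u + v) I = subvector u I + subvector v I"
  using assms subvector_carrier[of u] subvector_carrier[of v] subvector_carrier[of "u + v"]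
  by (intro eq_vecI) (auto simp: subvector_index pick_less)

lemma select_rows_mult_vec:
  assumes A: "A \<in> carrier_mat q N" and v: "v \<in> carrier_vec N"
  shows "select_rows A I *\<^sub>v v = subvector (A *\<^sub>v v) I"
proof (rule eq_vecI)
  have Av: "A *\<^sub>v v \<in> carrier_vec q" using A v by simp
  note sub = subvector_carrier[OF Av]
  then show "dim_vec (select_rows A I *\<^sub>v v) = dim_vec (subvector (A *\<^sub>v v) I)"
    using select_rows_carrier[OF A] by auto
  fix r assume "r < dim_vec (subvector (A *\<^sub>v v) I)"
  then have r: "r < card I" using sub by simp
  have "row (select_rows A I) r = row A (pick I r)"
  proof (rule eq_vecI)
    fix j assume "j < dim_vec (row A (pick I r))"
    then show "row (select_rows A I) r $ j = row A (pick I r) $ j"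
      using r A pick_less[OF r] select_rows_carrier[OF A] card_rows[OF I]
      by (auto simp: select_rows_def submatrix_index pick_UNIV)
  qed (use select_rows_carrier[OF A] A in auto)
  then show "(select_rows A I *\<^sub>v v) $ r = subvector (A *\<^sub>v v) I $ r"
    using r A select_rows_carrier[OF A] pick_less[OF r] by (simp add: subvector_index[OF Av])
qed

end


section \<open>Optimality conditions\<close>


text \<open>For independent rows this is the \<open>H\<close>-weighted least-norm solution of
  \<open>A z = c\<close>, with \<open>A\<close> the selected rows. The right-hand side
  \<open>c\<close> is a free argument since negative unit vectors are inserted too, to build test
  directions.\<close>

definition kkt_point :: "real mat \<Rightarrow> real mat \<Rightarrow> nat set \<Rightarrow> real vec \<Rightarrow> real vec" where
  "kkt_point H G I c = (mat_inv H * (select_rows G I)\<^sup>T * kkt_inv H G I) *\<^sub>v c"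

definition qp_min :: "real mat \<Rightarrow> real mat \<Rightarrow> real vec \<Rightarrow> real vec \<Rightarrow> bool" where
  "qp_min H G b z \<longleftrightarrow> z \<in> carrier_vec (dim_col G) \<and> G *\<^sub>v z \<le> b \<and>
     (\<forall>y \<in> carrier_vec (dim_col G). G *\<^sub>v y \<le> b \<longrightarrow> z \<bullet> (H *\<^sub>v z) \<le> y \<bullet> (H *\<^sub>v y))"

context
  fixes N q :: nat and H G :: "real mat"
  assumes pd: "sym_pos_def N H" and G: "G \<in> carrier_mat q N"
begin

lemma qp_min_exists:
  assumes b: "b \<in> carrier_vec q" and y: "y \<in> carrier_vec N" "G *\<^sub>v y \<le> b"
  shows "\<exists>z. qp_min H G b z"
proof -
  let ?C = "{y \<in> carrier_vec N. G *\<^sub>v y \<le> b}"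
  have "\<exists>z\<in>?C. \<forall>y\<in>?C. z \<bullet> (H *\<^sub>v z) \<le> y \<bullet> (H *\<^sub>v y)"
  proof (rule pos_def_minimizer_exists[OF pd])
    show "?C \<noteq> {}" using y by blast
    show "?C \<subseteq> carrier_vec N" by blast
  next
    fix u v assume uv: "u \<in> ?C" "v \<in> ?C"
    then have "G *\<^sub>v ((1/2) \<cdot>\<^sub>v (u + v)) = (1/2) \<cdot>\<^sub>v (G *\<^sub>v u + G *\<^sub>v v)"
      using mult_mat_vec[OF G, of "u + v" "1/2"] mult_add_distrib_mat_vec[OF G, of u v] by simp
    moreover have "(1/2) \<cdot>\<^sub>v (G *\<^sub>v u + G *\<^sub>v v) \<le> b"
    proof (unfold less_eq_vec_def, intro conjI allI impI)
      fix i assume i: "i < dim_vec b"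
      have "(G *\<^sub>v u) $ i \<le> b $ i" "(G *\<^sub>v v) $ i \<le> b $ i"
        using uv i by (auto simp: less_eq_vec_def)
      then show "((1/2) \<cdot>\<^sub>v (G *\<^sub>v u + G *\<^sub>v v)) $ i \<le> b $ i"
        using i b G by (simp add: field_simps)
    qed (use b G in auto)
    ultimately show "(1/2) \<cdot>\<^sub>v (u + v) \<in> ?C" using uv by auto
  next
    fix y :: "nat \<Rightarrow> real vec" and z
    assume y: "\<And>k. y k \<in> ?C" and z: "z \<in> carrier_vec N"
      and lim: "\<And>i. i < N \<Longrightarrow> (\<lambda>k. y k $ i) \<longlonglongrightarrow> z $ i"
    have "(G *\<^sub>v z) $ i \<le> b $ i" if i: "i < q" for i
    proof (rule LIMSEQ_le_const2)
      have *: "(G *\<^sub>v v) $ i = (\<Sum>j<N. G $$ (i, j) * v $ j)" if "v \<in> carrier_vec N" for v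
        using that i G by (auto simp: scalar_prod_def atLeast0LessThan intro!: sum.cong)
      have yN: "y k \<in> carrier_vec N" for k using y by blast
      show "(\<lambda>k. (G *\<^sub>v y k) $ i) \<longlonglongrightarrow> (G *\<^sub>v z) $ i"
        unfolding *[OF z] *[OF yN] by (intro tendsto_intros lim) auto
      show "\<exists>K. \<forall>k\<ge>K. (G *\<^sub>v y k) $ i \<le> b $ i"
        using y i b by (auto simp: less_eq_vec_def simp del: index_mult_mat_vec)
    qed
    then show "z \<in> ?C" using z b G by (auto simp: less_eq_vec_def)
  qed
  then show ?thesis using G by (auto simp: qp_min_def)
qed

text \<open>The first-order condition without multipliers. Inactive constraints have slack and are
  finitely many, so they survive a small step along \<open>d\<close>, while \<open>dir\<close>
  protects the active ones; a negative derivative would then lower the cost. The filter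
  \<open>at_right 0\<close> replaces an explicit step length.\<close>

lemma qp_min_feasible_direction:
  assumes b: "b \<in> carrier_vec q" and min: "qp_min H G b z" and d: "d \<in> carrier_vec N"
    and dir: "\<And>j. j < q \<Longrightarrow> (G *\<^sub>v z) $ j = b $ j \<Longrightarrow> (G *\<^sub>v d) $ j \<le> 0"
  shows "0 \<le> z \<bullet> (H *\<^sub>v d)"
proof (rule ccontr)
  assume neg: "\<not> 0 \<le> z \<bullet> (H *\<^sub>v d)"
  have z: "z \<in> carrier_vec N" "G *\<^sub>v z \<le> b" using min G by (auto simp: qp_min_def)
  have "\<forall>\<^sub>F t in at_right 0. \<forall>j\<in>{..<q}. (G *\<^sub>v z) $ j + t * (G *\<^sub>v d) $ j \<le> b $ j"
  proof (intro eventually_ball_finite finite_lessThan ballI)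
    fix j assume "j \<in> {..<q}"
    then have j: "j < q" by simp
    show "\<forall>\<^sub>F t in at_right 0. (G *\<^sub>v z) $ j + t * (G *\<^sub>v d) $ j \<le> b $ j"
    proof (cases "(G *\<^sub>v z) $ j = b $ j")
      case True
      then show ?thesis using dir[OF j True]
        by (auto intro!: eventually_mono[OF eventually_at_right_less[of 0]] mult_nonneg_nonpos)
    next
      case False
      then have less: "(G *\<^sub>v z) $ j < b $ j" using z(2) j b by (force simp: less_eq_vec_def)
      have "((\<lambda>t. (G *\<^sub>v z) $ j + t * (G *\<^sub>v d) $ j) \<longlongrightarrow> (G *\<^sub>v z) $ j + 0 * (G *\<^sub>v d) $ j) (at_right 0)"
        by (intro tendsto_intros)
      then show ?thesis using order_tendstoD(2)[of _ _ _ "b $ j"] less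
        by (force elim!: eventually_mono)
    qed
  qed
  \<comment> \<open>This is the change of the cost from \<open>z\<close> to \<open>z + t d\<close>,
    divided by \<open>t\<close>.\<close>
  moreover have "\<forall>\<^sub>F t in at_right 0. 2 * (z \<bullet> (H *\<^sub>v d)) + t * (d \<bullet> (H *\<^sub>v d)) < 0"
  proof -
    have "((\<lambda>t. 2 * (z \<bullet> (H *\<^sub>v d)) + t * (d \<bullet> (H *\<^sub>v d))) \<longlongrightarrow>
        2 * (z \<bullet> (H *\<^sub>v d)) + 0 * (d \<bullet> (H *\<^sub>v d))) (at_right 0)"
      by (intro tendsto_intros)
    then show ?thesis using order_tendstoD(2)[of _ _ _ 0] neg by force
  qed
  moreover have "\<forall>\<^sub>F t in at_right 0. (0::real) < t" by (rule eventually_at_right_less)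
  ultimately have "\<forall>\<^sub>F t in at_right 0. 0 < t \<and> 2 * (z \<bullet> (H *\<^sub>v d)) + t * (d \<bullet> (H *\<^sub>v d)) < 0 \<and>
      (\<forall>j\<in>{..<q}. (G *\<^sub>v z) $ j + t * (G *\<^sub>v d) $ j \<le> b $ j)"
    by (intro eventually_conj)
  then obtain t where t: "0 < t" "2 * (z \<bullet> (H *\<^sub>v d)) + t * (d \<bullet> (H *\<^sub>v d)) < 0"
      "\<And>j. j < q \<Longrightarrow> (G *\<^sub>v z) $ j + t * (G *\<^sub>v d) $ j \<le> b $ j"
    using eventually_happens'[OF trivial_limit_at_right_real[of 0]] by blast
  let ?y = "z + t \<cdot>\<^sub>v d"
  have y: "?y \<in> carrier_vec N" using z d by simp
  have "G *\<^sub>v ?y = G *\<^sub>v z + t \<cdot>\<^sub>v (G *\<^sub>v d)"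
    using mult_add_distrib_mat_vec[OF G z(1), of "t \<cdot>\<^sub>v d"] mult_mat_vec[OF G d] d by simp
  then have "G *\<^sub>v ?y \<le> b" using t(3) G b d by (auto simp: less_eq_vec_def)
  then have "z \<bullet> (H *\<^sub>v z) \<le> ?y \<bullet> (H *\<^sub>v ?y)" using min y G by (auto simp: qp_min_def)
  then have "0 \<le> t * (2 * (z \<bullet> (H *\<^sub>v d)) + t * (d \<bullet> (H *\<^sub>v d)))"
    unfolding pos_def_form_expand[OF pd z(1) d] by (simp add: power2_eq_square algebra_simps)
  then show False using t(1,2) by (simp add: zero_le_mult_iff)
qed

text \<open>From \<open>u\<close>, the direction \<open>v - u\<close> does not increase any active
  constraint, so the cross term in the expansion of the cost at \<open>v\<close> is nonnegative.
  Equal costs then leave no room for the form of \<open>v - u\<close>.\<close>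

lemma qp_min_unique:
  assumes b: "b \<in> carrier_vec q" and u: "qp_min H G b u" and v: "qp_min H G b v"
  shows "u = v"
proof -
  have c: "u \<in> carrier_vec N" "v \<in> carrier_vec N" "G *\<^sub>v u \<le> b" "G *\<^sub>v v \<le> b"
    using u v G by (auto simp: qp_min_def)
  define e where "e = v - u"
  have e: "e \<in> carrier_vec N" using c by (simp add: e_def)
  have "G *\<^sub>v e = G *\<^sub>v v - G *\<^sub>v u" using mult_minus_distrib_mat_vec[OF G c(2,1)] by (simp add: e_def)
  then have "0 \<le> u \<bullet> (H *\<^sub>v e)"
    using c G b by (intro qp_min_feasible_direction[OF b u e]) (auto simp: less_eq_vec_def)
  moreover have "v = u + 1 \<cdot>\<^sub>v e" using c by (intro eq_vecI) (auto simp: e_def)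
  moreover have "v \<bullet> (H *\<^sub>v v) \<le> u \<bullet> (H *\<^sub>v u)" using v c G by (auto simp: qp_min_def)
  ultimately have "e \<bullet> (H *\<^sub>v e) \<le> 0" using pos_def_form_expand[OF pd c(1) e, of 1] by simp
  then have "e = 0\<^sub>v N" using pos_def_form_eq_0[OF pd e] by simp
  then show ?thesis using \<open>v = u + 1 \<cdot>\<^sub>v e\<close> c by auto
qed

section \<open>Candidate points of an index set with independent rows\<close>

context
  fixes I :: "nat set"
  assumes I: "I \<subseteq> {..<q}" and li: "lin_indpt_rows (select_rows G I)"
begin

lemma select_G_carrier: "select_rows G I \<in> carrier_mat (card I) N"
  by (rule select_rows_carrier[OF I G])

lemma kkt_gram_pos_def: "sym_pos_def (card I) (select_rows G I * mat_inv H * (select_rows G I)\<^sup>T)"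
  by (rule pos_def_gram[OF pd select_G_carrier li])

lemma kkt_inv_carrier: "kkt_inv H G I \<in> carrier_mat (card I) (card I)"
  unfolding kkt_inv_def by (rule pos_def_mat_inv(1)[OF kkt_gram_pos_def])

lemma kkt_point_eq:
  assumes c: "c \<in> carrier_vec (card I)"
  shows "kkt_point H G I c = mat_inv H *\<^sub>v ((select_rows G I)\<^sup>T *\<^sub>v (kkt_inv H G I *\<^sub>v c))"
proof -
  note J = pos_def_mat_inv(1)[OF pd]
  have T: "(select_rows G I)\<^sup>T \<in> carrier_mat N (card I)" using select_G_carrier by simp
  have k: "kkt_inv H G I *\<^sub>v c \<in> carrier_vec (card I)" using kkt_inv_carrier c by simp
  show ?thesis
    unfolding kkt_point_def assoc_mult_mat_vec[OF mult_carrier_mat[OF J T] kkt_inv_carrier c]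
    by (rule assoc_mult_mat_vec[OF J T k])
qed

lemma kkt_point_carrier: "c \<in> carrier_vec (card I) \<Longrightarrow> kkt_point H G I c \<in> carrier_vec N"
  unfolding kkt_point_def using pos_def_mat_inv(1)[OF pd] select_G_carrier kkt_inv_carrier
  by (intro mult_mat_vec_carrier[of _ _ "card I"] mult_carrier_mat) auto

lemma select_G_kkt_point:
  assumes c: "c \<in> carrier_vec (card I)"
  shows "select_rows G I *\<^sub>v kkt_point H G I c = c"
proof -
  let ?A = "select_rows G I"
  note J = pos_def_mat_inv(1)[OF pd]
  have T: "?A\<^sup>T \<in> carrier_mat N (card I)" using select_G_carrier by simp
  have k: "kkt_inv H G I *\<^sub>v c \<in> carrier_vec (card I)" using kkt_inv_carrier c by simp
  have Tk: "?A\<^sup>T *\<^sub>v (kkt_inv H G I *\<^sub>v c) \<in> carrier_vec N" using T k by simp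
  have "?A *\<^sub>v kkt_point H G I c = (?A * mat_inv H * ?A\<^sup>T) *\<^sub>v (kkt_inv H G I *\<^sub>v c)"
    unfolding kkt_point_eq[OF c] assoc_mult_mat_vec[OF mult_carrier_mat[OF select_G_carrier J] T k]
    by (rule assoc_mult_mat_vec[OF select_G_carrier J Tk, symmetric])
  also have "\<dots> = c"
    unfolding kkt_inv_def by (rule pos_def_mat_inv_vec(2)[OF kkt_gram_pos_def c])
  finally show ?thesis .
qed

text \<open>\<open>H\<close> cancels against its inverse, leaving the transposed active rows applied
  to \<open>kkt_inv H G I *\<^sub>v c\<close>. This is stationarity in weak form: that vector is
  minus half the Lagrange multiplier, and the gradient at the candidate sees \<open>y\<close> only
  through the selected rows.\<close>

lemma kkt_point_form:
  assumes c: "c \<in> carrier_vec (card I)" and y: "y \<in> carrier_vec N"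
  shows "kkt_point H G I c \<bullet> (H *\<^sub>v y) = (kkt_inv H G I *\<^sub>v c) \<bullet> (select_rows G I *\<^sub>v y)"
proof -
  let ?A = "select_rows G I"
  have T: "?A\<^sup>T \<in> carrier_mat N (card I)" using select_G_carrier by simp
  have k: "kkt_inv H G I *\<^sub>v c \<in> carrier_vec (card I)" using kkt_inv_carrier c by simp
  have Tk: "?A\<^sup>T *\<^sub>v (kkt_inv H G I *\<^sub>v c) \<in> carrier_vec N" using T k by simp
  have "kkt_point H G I c \<bullet> (H *\<^sub>v y) = y \<bullet> (?A\<^sup>T *\<^sub>v (kkt_inv H G I *\<^sub>v c))"
    unfolding pos_def_form_sym[OF pd kkt_point_carrier[OF c] y]
    unfolding kkt_point_eq[OF c] pos_def_mat_inv_vec(2)[OF pd Tk] ..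
  also have "\<dots> = (?A\<^sup>T *\<^sub>v (kkt_inv H G I *\<^sub>v c)) \<bullet> y" by (rule comm_scalar_prod[OF y Tk])
  also have "\<dots> = (kkt_inv H G I *\<^sub>v c) \<bullet> (?A *\<^sub>v y)"
    by (rule transpose_vec_mult_scalar[OF select_G_carrier y k])
  finally show ?thesis .
qed

text \<open>For feasible \<open>y\<close> the selected rows of \<open>y - ?z\<close> are
  nonpositive, since those of \<open>?z\<close> equal the bound. Paired with nonpositive
  \<open>kkt_inv H G I *\<^sub>v ?c\<close> they give a nonnegative cross term. As \<open>I\<close>
  is arbitrary, this also covers regions whose index set differs from the active set at the
  optimum.\<close>

lemma qp_min_kkt_point:
  assumes b: "b \<in> carrier_vec q" and feas: "G *\<^sub>v kkt_point H G I (subvector b I) \<le> b"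
    and mult: "kkt_inv H G I *\<^sub>v subvector b I \<le> 0\<^sub>v (card I)"
  shows "qp_min H G b (kkt_point H G I (subvector b I))"
proof -
  let ?c = "subvector b I" let ?z = "kkt_point H G I ?c"
  have c: "?c \<in> carrier_vec (card I)" by (rule subvector_carrier[OF I b])
  note z = kkt_point_carrier[OF c]
  have "?z \<bullet> (H *\<^sub>v ?z) \<le> y \<bullet> (H *\<^sub>v y)" if y: "y \<in> carrier_vec N" "G *\<^sub>v y \<le> b" for y
  proof -
    define e where "e = y - ?z"
    have e: "e \<in> carrier_vec N" "y = ?z + 1 \<cdot>\<^sub>v e"
      using y z by (auto simp: e_def intro!: eq_vecI)
    have Gy: "G *\<^sub>v y \<in> carrier_vec q" using G y by simp
    have "select_rows G I *\<^sub>v e = subvector (G *\<^sub>v y) I - ?c"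
      unfolding e_def mult_minus_distrib_mat_vec[OF select_G_carrier y(1) z] select_G_kkt_point[OF c]
        select_rows_mult_vec[OF I G y(1)] ..
    moreover have "subvector (G *\<^sub>v y) I $ r \<le> ?c $ r" if "r < card I" for r
      using that y(2) b pick_less[OF I that]
      by (simp add: subvector_index[OF I] Gy less_eq_vec_def del: index_mult_mat_vec)
    ultimately have neg: "(select_rows G I *\<^sub>v e) $ r \<le> 0" if "r < card I" for r
      using that c subvector_carrier[OF I Gy] by simp
    have "?z \<bullet> (H *\<^sub>v e) = (\<Sum>r<card I. (kkt_inv H G I *\<^sub>v ?c) $ r * (select_rows G I *\<^sub>v e) $ r)"
      unfolding kkt_point_form[OF c e(1)] unfolding scalar_prod_def
      using select_G_carrier by (simp add: atLeast0LessThan del: index_mult_mat_vec)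
    also have "\<dots> \<ge> 0"
      using mult neg by (intro sum_nonneg mult_nonpos_nonpos) (auto simp: less_eq_vec_def)
    finally have "0 \<le> ?z \<bullet> (H *\<^sub>v e)" .
    then show ?thesis
      using pos_def_form_expand[OF pd z e(1), of 1] pos_def_form_nonneg[OF pd e(1)] e(2) by simp
  qed
  then show ?thesis using z feas G by (auto simp: qp_min_def)
qed

text \<open>
  Both conclusions come from testing optimality in feasible directions: first along the difference
  to the candidate, which lies in the kernel of the active rows, then along the preimages of the
  negative unit vectors under the active rows.
\<close>

lemma qp_min_imp_kkt:
  assumes b: "b \<in> carrier_vec q" and min: "qp_min H G b z"
    and act: "I = {j. j < q \<and> (G *\<^sub>v z) $ j = b $ j}"
  shows "z = kkt_point H G I (subvector b I)" "kkt_inv H G I *\<^sub>v subvector b I \<le> 0\<^sub>v (card I)"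
proof -
  let ?c = "subvector b I" let ?A = "select_rows G I"
  have c: "?c \<in> carrier_vec (card I)" by (rule subvector_carrier[OF I b])
  note w = kkt_point_carrier[OF c]
  have z: "z \<in> carrier_vec N" using min G by (auto simp: qp_min_def)
  have Gz: "G *\<^sub>v z \<in> carrier_vec q" using G z by simp
  have "subvector (G *\<^sub>v z) I = ?c"
  proof (rule eq_vecI)
    fix r assume "r < dim_vec ?c"
    then have r: "r < card I" using c by simp
    then have "pick I r \<in> I" by (intro pick_in_set) auto
    then show "subvector (G *\<^sub>v z) I $ r = ?c $ r"
      using subvector_index[OF I Gz r] subvector_index[OF I b r] act by auto
  qed (use c subvector_carrier[OF I Gz] in auto)
  then have Az: "?A *\<^sub>v z = ?c" by (simp add: select_rows_mult_vec[OF I G z])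
  \<comment> \<open>The first-order condition restated for rows of \<open>?A\<close>: by
    \<open>pick_range\<close> these rows are exactly the active constraints.\<close>
  have test: "0 \<le> z \<bullet> (H *\<^sub>v v)"
    if v: "v \<in> carrier_vec N" "\<And>r. r < card I \<Longrightarrow> (?A *\<^sub>v v) $ r \<le> 0" for v
  proof (rule qp_min_feasible_direction[OF b min v(1)])
    fix j assume "j < q" "(G *\<^sub>v z) $ j = b $ j"
    then have "j \<in> pick I ` {..<card I}" unfolding pick_range[OF I] unfolding act by simp
    then obtain r where r: "r < card I" "j = pick I r" by (elim imageE) simp
    have "(?A *\<^sub>v v) $ r = (G *\<^sub>v v) $ j"
      unfolding select_rows_mult_vec[OF I G v(1)] r(2)
      by (rule subvector_index[OF I mult_mat_vec_carrier[OF G v(1)] r(1)])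
    then show "(G *\<^sub>v v) $ j \<le> 0" using v(2)[OF r(1)] by simp
  qed
  define e where "e = kkt_point H G I ?c - z"
  have e: "e \<in> carrier_vec N" using w z by (simp add: e_def)
  have Ae: "?A *\<^sub>v e = 0\<^sub>v (card I)"
    unfolding e_def mult_minus_distrib_mat_vec[OF select_G_carrier w z] select_G_kkt_point[OF c] Az
    using c by simp
  have "0 \<le> z \<bullet> (H *\<^sub>v e)" using test[OF e] Ae by simp
  moreover have "kkt_point H G I ?c \<bullet> (H *\<^sub>v e) = 0"
    unfolding kkt_point_form[OF c e] Ae using kkt_inv_carrier c by simp
  \<comment> \<open>The candidate is \<open>H\<close>-orthogonal to the kernel of \<open>?A\<close>,
    so only the nonpositive second term remains. The \<open>arg_cong\<close> instance unfolds
    \<open>e\<close> in the left factor alone.\<close>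
  moreover have "e \<bullet> (H *\<^sub>v e) = kkt_point H G I ?c \<bullet> (H *\<^sub>v e) - z \<bullet> (H *\<^sub>v e)"
    unfolding e_def[THEN arg_cong[of _ _ "\<lambda>v. v \<bullet> (H *\<^sub>v e)"]]
    using minus_scalar_prod_distrib[OF w z, of "H *\<^sub>v e"] pos_def_carrier[OF pd] e by simp
  ultimately have "e \<bullet> (H *\<^sub>v e) \<le> 0" by simp
  then have e0: "e = 0\<^sub>v N" by (rule pos_def_form_eq_0[OF pd e])
  show zw: "z = kkt_point H G I ?c"
  proof (rule eq_vecI)
    fix i assume "i < dim_vec (kkt_point H G I ?c)"
    then have i: "i < N" using w by simp
    have "e $ i = kkt_point H G I ?c $ i - z $ i" using i z by (simp add: e_def)
    then show "z $ i = kkt_point H G I ?c $ i" using i e0 by simp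
  qed (use z w in auto)
  show "kkt_inv H G I *\<^sub>v ?c \<le> 0\<^sub>v (card I)"
  proof (unfold less_eq_vec_def, intro conjI allI impI)
    fix r assume "r < dim_vec (0\<^sub>v (card I) :: real vec)"
    then have r: "r < card I" by simp
    define f :: "real vec" where "f = - unit_vec (card I) r"
    have f: "f \<in> carrier_vec (card I)" by (simp add: f_def)
    have "0 \<le> z \<bullet> (H *\<^sub>v kkt_point H G I f)"
    proof (rule test[OF kkt_point_carrier[OF f]])
      show "(?A *\<^sub>v kkt_point H G I f) $ r' \<le> 0" if "r' < card I" for r'
        unfolding select_G_kkt_point[OF f] using that r by (simp add: f_def unit_vec_def)
    qed
    also have "\<dots> = (kkt_inv H G I *\<^sub>v ?c) \<bullet> f"
      unfolding zw kkt_point_form[OF c kkt_point_carrier[OF f]] select_G_kkt_point[OF f] ..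
    also have "\<dots> = - (kkt_inv H G I *\<^sub>v ?c) $ r"
      using r kkt_inv_carrier by (simp add: f_def)
    finally show "(kkt_inv H G I *\<^sub>v ?c) $ r \<le> 0\<^sub>v (card I) $ r" using r by simp
  qed (use kkt_inv_carrier in auto)
qed

end

end

section \<open>Positive definiteness of the condensed Hessian\<close>

lemma congruence_form:
  fixes P :: "real mat"
  assumes P: "P \<in> carrier_mat r r" and A: "A \<in> carrier_mat r N" and v: "v \<in> carrier_vec N"
  shows "v \<bullet> ((A\<^sup>T * P * A) *\<^sub>v v) = (A *\<^sub>v v) \<bullet> (P *\<^sub>v (A *\<^sub>v v))"
proof -
  have T: "A\<^sup>T \<in> carrier_mat N r" using A by simp
  have Av: "A *\<^sub>v v \<in> carrier_vec r" using A v by simp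
  have PAv: "P *\<^sub>v (A *\<^sub>v v) \<in> carrier_vec r" using P Av by simp
  have "(A\<^sup>T * P * A) *\<^sub>v v = A\<^sup>T *\<^sub>v (P *\<^sub>v (A *\<^sub>v v))"
    using assoc_mult_mat_vec[OF mult_carrier_mat[OF T P] A v] assoc_mult_mat_vec[OF T P Av] by simp
  moreover have "v \<bullet> (A\<^sup>T *\<^sub>v (P *\<^sub>v (A *\<^sub>v v))) = (A\<^sup>T *\<^sub>v (P *\<^sub>v (A *\<^sub>v v))) \<bullet> v"
    using comm_scalar_prod[OF v mult_mat_vec_carrier[OF T PAv]] .
  ultimately show ?thesis
    using transpose_vec_mult_scalar[OF A v PAv] comm_scalar_prod[OF PAv Av] by simp
qed

lemma sym_pos_def_imp_semidef: "sym_pos_def n A \<Longrightarrow> sym_pos_semidef n A"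
  using pos_def_form_nonneg by (auto simp: sym_pos_semidef_def sym_pos_def_def)

lemma sym_pos_semidef_congruence:
  assumes P: "sym_pos_semidef r P" and A: "A \<in> carrier_mat r N"
  shows "sym_pos_semidef N (A\<^sup>T * P * A)"
proof -
  have c: "P \<in> carrier_mat r r" "P\<^sup>T = P" using P by (auto simp: sym_pos_semidef_def)
  have "(A\<^sup>T * P * A)\<^sup>T = A\<^sup>T * (A\<^sup>T * P)\<^sup>T"
    using transpose_mult[of "A\<^sup>T * P" N r A N] A c by simp
  also have "(A\<^sup>T * P)\<^sup>T = P * A" using transpose_mult[of "A\<^sup>T" N r P r] A c by simp
  also have "A\<^sup>T * (P * A) = A\<^sup>T * P * A"
    using assoc_mult_mat[of "A\<^sup>T" N r P r A N] A c by simp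
  finally show ?thesis
    using P A c congruence_form[OF c(1) A] by (auto simp: sym_pos_semidef_def)
qed

lemma form_add:
  fixes A B :: "real mat"
  assumes "A \<in> carrier_mat N N" "B \<in> carrier_mat N N" "v \<in> carrier_vec N"
  shows "v \<bullet> ((A + B) *\<^sub>v v) = v \<bullet> (A *\<^sub>v v) + v \<bullet> (B *\<^sub>v v)"
  using assms by (simp add: add_mult_distrib_mat_vec[of _ N N] scalar_prod_add_distrib[of _ N])

lemma sym_pos_semidef_add:
  assumes "sym_pos_semidef N A" "sym_pos_semidef N B"
  shows "sym_pos_semidef N (A + B)"
  using assms transpose_add[of A N N B] form_add[of A N B] by (auto simp: sym_pos_semidef_def)

lemma form_mat_sum:
  fixes f :: "nat \<Rightarrow> real mat"
  assumes f: "\<And>k. k \<in> S \<Longrightarrow> f k \<in> carrier_mat N N" and v: "v \<in> carrier_vec N"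
  shows "v \<bullet> (mat_sum N N f S *\<^sub>v v) = (\<Sum>k\<in>S. v \<bullet> (f k *\<^sub>v v))"
proof -
  have form: "v \<bullet> (A *\<^sub>v v) = (\<Sum>i<N. \<Sum>j<N. v $ i * (A $$ (i, j) * v $ j))"
    if "A \<in> carrier_mat N N" for A
    using that v by (auto simp: scalar_prod_def atLeast0LessThan sum_distrib_left intro!: sum.cong)
  have "v \<bullet> (mat_sum N N f S *\<^sub>v v) = (\<Sum>i<N. \<Sum>j<N. \<Sum>k\<in>S. v $ i * (f k $$ (i, j) * v $ j))"
    by (subst form) (simp_all add: mat_sum_def sum_distrib_left sum_distrib_right)
  also have "\<dots> = (\<Sum>i<N. \<Sum>k\<in>S. \<Sum>j<N. v $ i * (f k $$ (i, j) * v $ j))"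
    by (intro sum.cong refl sum.swap)
  also have "\<dots> = (\<Sum>k\<in>S. \<Sum>i<N. \<Sum>j<N. v $ i * (f k $$ (i, j) * v $ j))"
    by (rule sum.swap)
  also have "\<dots> = (\<Sum>k\<in>S. v \<bullet> (f k *\<^sub>v v))"
    by (intro sum.cong refl) (simp add: form[OF f])
  finally show ?thesis .
qed

lemma sym_pos_semidef_mat_sum:
  assumes f: "\<And>k. k \<in> S \<Longrightarrow> sym_pos_semidef N (f k)"
  shows "sym_pos_semidef N (mat_sum N N f S)"
proof -
  have c: "f k \<in> carrier_mat N N" "(f k)\<^sup>T = f k" if "k \<in> S" for k
    using f[OF that] by (auto simp: sym_pos_semidef_def)
  have "f k $$ (j, i) = f k $$ (i, j)" if "k \<in> S" "i < N" "j < N" for k i j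
    using index_transpose_mat(1)[of i "f k" j] c[OF that(1)] that by simp
  then have "(mat_sum N N f S)\<^sup>T = mat_sum N N f S"
    by (intro eq_matI) (auto simp: mat_sum_def intro!: sum.cong)
  moreover have "mat_sum N N f S \<in> carrier_mat N N" by (simp add: mat_sum_def)
  ultimately show ?thesis
    using f form_mat_sum[OF c(1)] by (auto simp: sym_pos_semidef_def intro!: sum_nonneg)
qed

text \<open>A nonzero input vector has a nonzero block \<open>k < Nu\<close>. Since
  \<open>Nu \<le> Nx\<close>, the stage sum contains the term for \<open>k\<close>, where
  \<open>Lambda_mat\<close> merely selects that block and \<open>R\<close> makes the term positive;
  all other terms are nonnegative.\<close>

lemma sym_pos_def_cost_H:
  assumes \<gamma>: "\<gamma> \<in> carrier_mat n m" and \<xi>: "\<xi> \<in> carrier_mat n n" and K: "K \<in> carrier_mat m n"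
    and Q: "sym_pos_semidef n Q" and P: "sym_pos_semidef n P" and R: "sym_pos_def m R"
    and le: "Nu \<le> Nx"
  shows "sym_pos_def (m * Nu) (cost_H \<gamma> \<xi> K Nu Nx P Q R)"
proof -
  let ?N = "m * Nu"
  let ?\<Psi> = "Psi_mat \<gamma> \<xi> K Nu" and ?\<Lambda> = "Lambda_mat \<gamma> \<xi> K Nu"
  define f where "f k = (?\<Psi> k)\<^sup>T * Q * ?\<Psi> k + (?\<Lambda> k)\<^sup>T * R * ?\<Lambda> k" for k
  define T where "T = (?\<Psi> Nx)\<^sup>T * P * ?\<Psi> Nx"
  note c = Psi_mat_carrier[OF \<gamma> \<xi> K] Lambda_mat_carrier[OF \<gamma> \<xi> K]
  have H: "cost_H \<gamma> \<xi> K Nu Nx P Q R = T + mat_sum ?N ?N f {..<Nx}"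
    using \<gamma> by (simp add: cost_H_def f_def[abs_def] T_def Let_def)
  have Rs: "sym_pos_semidef m R" by (rule sym_pos_def_imp_semidef[OF R])
  have T: "sym_pos_semidef ?N T" unfolding T_def by (rule sym_pos_semidef_congruence[OF P c(1)])
  have Qf: "sym_pos_semidef ?N ((?\<Psi> k)\<^sup>T * Q * ?\<Psi> k)"
    and Rf: "sym_pos_semidef ?N ((?\<Lambda> k)\<^sup>T * R * ?\<Lambda> k)" for k
    by (rule sym_pos_semidef_congruence[OF Q c(1)], rule sym_pos_semidef_congruence[OF Rs c(2)])
  have f: "sym_pos_semidef ?N (f k)" for k
    unfolding f_def by (rule sym_pos_semidef_add[OF Qf Rf])
  have sum: "sym_pos_semidef ?N (mat_sum ?N ?N f {..<Nx})"
    by (rule sym_pos_semidef_mat_sum[OF f])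
  have "0 < v \<bullet> ((T + mat_sum ?N ?N f {..<Nx}) *\<^sub>v v)"
    if v: "v \<in> carrier_vec ?N" "v \<noteq> 0\<^sub>v ?N" for v
  proof -
    obtain i where i: "i < ?N" "v $ i \<noteq> 0" using v by (metis carrier_vecD eq_vecI index_zero_vec)
    then have "0 < m" by (cases m) auto
    \<comment> \<open>The block containing component \<open>i\<close>, whose position inside the
      block is \<open>i mod m\<close>.\<close>
    define k where "k = i div m"
    have k: "k < Nu" using i(1) by (simp add: k_def less_mult_imp_div_less mult.commute)
    have "input_block m v k $ (i mod m) = v $ i"
      using \<open>0 < m\<close> by (simp add: input_block_def k_def)
    then have "input_block m v k \<noteq> 0\<^sub>v m" using i(2) \<open>0 < m\<close> by auto
    moreover have "?\<Lambda> k *\<^sub>v v = input_block m v k"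
      using k \<gamma> input_selector_mult[OF \<gamma> \<xi> K v(1) k] by (simp add: Lambda_mat_def)
    ultimately have "0 < (?\<Lambda> k *\<^sub>v v) \<bullet> (R *\<^sub>v (?\<Lambda> k *\<^sub>v v))"
      using R by (simp add: sym_pos_def_def input_block_def)
    also have "\<dots> = v \<bullet> ((?\<Lambda> k)\<^sup>T * R * ?\<Lambda> k *\<^sub>v v)"
      using congruence_form[OF pos_def_carrier[OF R] c(2) v(1)] by simp
    also have "\<dots> \<le> v \<bullet> (f k *\<^sub>v v)"
      unfolding f_def using Qf[of k] Rf[of k] v(1)
      by (subst form_add[of _ ?N]) (auto simp: sym_pos_semidef_def)
    also have "\<dots> \<le> (\<Sum>k<Nx. v \<bullet> (f k *\<^sub>v v))"
      using k le f v(1) by (intro member_le_sum) (auto simp: sym_pos_semidef_def)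
    also have "\<dots> = v \<bullet> (mat_sum ?N ?N f {..<Nx} *\<^sub>v v)"
      using f v(1) by (intro form_mat_sum[symmetric]) (auto simp: sym_pos_semidef_def)
    also have "\<dots> \<le> v \<bullet> ((T + mat_sum ?N ?N f {..<Nx}) *\<^sub>v v)"
      using T sum v(1) by (subst form_add[of _ ?N]) (auto simp: sym_pos_semidef_def)
    finally show ?thesis .
  qed
  then show ?thesis
    unfolding H using sym_pos_semidef_add[OF T sum]
    by (auto simp: sym_pos_def_def sym_pos_semidef_def)
qed


section \<open>The explicit law\<close>

lemma less_eq_uminus_iff:
  fixes a :: "real vec"
  assumes "a \<in> carrier_vec k" "b \<in> carrier_vec k"
  shows "a \<le> - b \<longleftrightarrow> b + a \<le> 0\<^sub>v k"
proof -
  have "a $ i \<le> - b $ i \<longleftrightarrow> b $ i + a $ i \<le> 0" for i by linarith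
  then show ?thesis using assms by (simp add: less_eq_vec_def)
qed

lemma minus_le_uminus_add_iff:
  fixes a :: "real vec"
  assumes "a \<in> carrier_vec k" "b \<in> carrier_vec k" "c \<in> carrier_vec k" "w \<in> carrier_vec k"
  shows "a - c \<le> - b + w \<longleftrightarrow> b + a \<le> w + c"
proof -
  have "a $ i - c $ i \<le> - b $ i + w $ i \<longleftrightarrow> b $ i + a $ i \<le> w $ i + c $ i" for i by linarith
  then show ?thesis using assms by (simp add: less_eq_vec_def)
qed

context
  fixes n N q :: nat and H F G S :: "real mat" and W :: "real vec" and I :: "nat set"
  assumes pd: "sym_pos_def N H" and F: "F \<in> carrier_mat n N" and G: "G \<in> carrier_mat q N"
    and S: "S \<in> carrier_mat q n" and W: "W \<in> carrier_vec q"
    and I: "I \<subseteq> {..<q}" and li: "lin_indpt_rows (select_rows G I)"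
begin

lemma kkt_gain_carrier:
  "mat_inv H * (select_rows G I)\<^sup>T * kkt_inv H G I \<in> carrier_mat N (card I)"
  using pos_def_mat_inv(1)[OF pd] select_G_carrier[OF pd G I li] kkt_inv_carrier[OF pd G I li]
  by simp

lemma subvector_rhs:
  assumes x: "x \<in> carrier_vec n"
  shows "subvector (W + S *\<^sub>v x) I = subvector W I + select_rows S I *\<^sub>v x"
proof -
  have "S *\<^sub>v x \<in> carrier_vec q" using S x by simp
  then show ?thesis using subvector_add[OF I W] select_rows_mult_vec[OF I S x] by simp
qed

text \<open>Undoes the substitution \<open>z = U + H^-1 F' x\<close> that completes the square in
  the cost. The remaining candidate point is linear in its right-hand side, which splits into the
  \<open>W\<close> part and the \<open>S x\<close> part.\<close>

lemma law_eq:
  assumes x: "x \<in> carrier_vec n"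
  shows "law_F H F G S I *\<^sub>v x + law_G H G W I =
    kkt_point H G I (subvector (W + S *\<^sub>v x) I) - (mat_inv H * F\<^sup>T) *\<^sub>v x"
proof -
  let ?C = "mat_inv H * (select_rows G I)\<^sup>T * kkt_inv H G I"
  note C = kkt_gain_carrier
  have SI: "select_rows S I \<in> carrier_mat (card I) n" by (rule select_rows_carrier[OF I S])
  have WI: "subvector W I \<in> carrier_vec (card I)" by (rule subvector_carrier[OF I W])
  have J: "mat_inv H * F\<^sup>T \<in> carrier_mat N n" using pos_def_mat_inv(1)[OF pd] F by simp
  have SIx: "select_rows S I *\<^sub>v x \<in> carrier_vec (card I)" using SI x by simp
  have "law_F H F G S I *\<^sub>v x = ?C *\<^sub>v (select_rows S I *\<^sub>v x) - (mat_inv H * F\<^sup>T) *\<^sub>v x"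
    unfolding law_F_def minus_mult_distrib_mat_vec[OF mult_carrier_mat[OF C SI] J x]
      assoc_mult_mat_vec[OF C SI x] ..
  moreover have "?C *\<^sub>v (subvector W I + select_rows S I *\<^sub>v x) =
      ?C *\<^sub>v subvector W I + ?C *\<^sub>v (select_rows S I *\<^sub>v x)"
    by (rule mult_add_distrib_mat_vec[OF C WI SIx])
  moreover have "?C *\<^sub>v subvector W I \<in> carrier_vec N"
      "?C *\<^sub>v (select_rows S I *\<^sub>v x) \<in> carrier_vec N" "(mat_inv H * F\<^sup>T) *\<^sub>v x \<in> carrier_vec N"
    using C WI SIx J x by (auto intro: mult_mat_vec_carrier)
  ultimately show ?thesis
    unfolding subvector_rhs[OF x] kkt_point_def law_G_def
    by (intro eq_vecI) (auto simp del: index_mult_mat_vec)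
qed

text \<open>The stacked inequality splits by \<open>append_vec_le\<close>. Moving the
  \<open>W\<close> terms across in each block reassembles
  \<open>subvector W I + select_rows S I *\<^sub>v x\<close>, the right-hand side of the candidate:
  the first block is dual feasibility, the second primal feasibility.\<close>

lemma region_iff:
  assumes x: "x \<in> carrier_vec n"
  shows "region_H H G S I *\<^sub>v x \<le> region_K H G W I \<longleftrightarrow>
    kkt_inv H G I *\<^sub>v subvector (W + S *\<^sub>v x) I \<le> 0\<^sub>v (card I) \<and>
    G *\<^sub>v kkt_point H G I (subvector (W + S *\<^sub>v x) I) \<le> W + S *\<^sub>v x"
proof -
  let ?J = "mat_inv H" let ?A = "select_rows G I" let ?k = "kkt_inv H G I"
  let ?C = "?J * ?A\<^sup>T * ?k" let ?s = "select_rows S I" let ?w = "subvector W I"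
  note J = pos_def_mat_inv(1)[OF pd] note C = kkt_gain_carrier
  note k = kkt_inv_carrier[OF pd G I li]
  have T: "?A\<^sup>T \<in> carrier_mat N (card I)" using select_G_carrier[OF pd G I li] by simp
  have s: "?s \<in> carrier_mat (card I) n" by (rule select_rows_carrier[OF I S])
  have w: "?w \<in> carrier_vec (card I)" by (rule subvector_carrier[OF I W])
  have sx: "?s *\<^sub>v x \<in> carrier_vec (card I)" using s x by simp
  have GC: "G * ?J * ?A\<^sup>T * ?k = G * ?C"
    unfolding assoc_mult_mat[OF G J T] by (rule assoc_mult_mat[OF G mult_carrier_mat[OF J T] k])
  have GCc: "G * ?C \<in> carrier_mat q (card I)" using G C by simp
  note v = mult_mat_vec_carrier[OF k w] mult_mat_vec_carrier[OF k sx]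
    mult_mat_vec_carrier[OF GCc w] mult_mat_vec_carrier[OF GCc sx] mult_mat_vec_carrier[OF S x]
  have "region_H H G S I *\<^sub>v x =
      (?k *\<^sub>v (?s *\<^sub>v x)) @\<^sub>v ((G * ?C) *\<^sub>v (?s *\<^sub>v x) - S *\<^sub>v x)"
    unfolding region_H_def GC mat_mult_append[OF mult_carrier_mat[OF k s]
        minus_carrier_mat[OF S, of "G * ?C * ?s"] x]
      assoc_mult_mat_vec[OF k s x] minus_mult_distrib_mat_vec[OF mult_carrier_mat[OF GCc s] S x]
      assoc_mult_mat_vec[OF GCc s x] ..
  then have "region_H H G S I *\<^sub>v x \<le> region_K H G W I \<longleftrightarrow>
      ?k *\<^sub>v (?s *\<^sub>v x) \<le> - (?k *\<^sub>v ?w) \<and>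
      (G * ?C) *\<^sub>v (?s *\<^sub>v x) - S *\<^sub>v x \<le> - ((G * ?C) *\<^sub>v ?w) + W"
    unfolding region_K_def GC using v
    by (simp add: append_vec_le[of _ "card I"])
  also have "?k *\<^sub>v (?s *\<^sub>v x) \<le> - (?k *\<^sub>v ?w) \<longleftrightarrow> ?k *\<^sub>v (?w + ?s *\<^sub>v x) \<le> 0\<^sub>v (card I)"
    unfolding mult_add_distrib_mat_vec[OF k w sx] by (rule less_eq_uminus_iff[OF v(2,1)])
  also have "(G * ?C) *\<^sub>v (?s *\<^sub>v x) - S *\<^sub>v x \<le> - ((G * ?C) *\<^sub>v ?w) + W \<longleftrightarrow>
      (G * ?C) *\<^sub>v ?w + (G * ?C) *\<^sub>v (?s *\<^sub>v x) \<le> W + S *\<^sub>v x"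
    by (rule minus_le_uminus_add_iff[OF v(4,3,5) W])
  also have "(G * ?C) *\<^sub>v ?w + (G * ?C) *\<^sub>v (?s *\<^sub>v x) = G *\<^sub>v (?C *\<^sub>v (?w + ?s *\<^sub>v x))"
    using mult_add_distrib_mat_vec[OF GCc w sx] assoc_mult_mat_vec[OF G C, of "?w + ?s *\<^sub>v x"] w sx
    by simp
  finally show ?thesis by (simp add: subvector_rhs[OF x] kkt_point_def)
qed

end

section \<open>From the fixed right-hand side back to the parametric data-driven program\<close>

lemma qp_solution_iff_qp_min: "qp_solution H G W S x z \<longleftrightarrow> qp_min H G (W + S *\<^sub>v x) z"
  by (auto simp: qp_solution_def qp_feasible_def qp_min_def)

lemma vec_first_affine:
  fixes A :: "real mat"
  assumes A: "A \<in> carrier_mat N n" and b: "b \<in> carrier_vec N" and x: "x \<in> carrier_vec n" and "m \<le> N"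
  shows "vec_first (A *\<^sub>v x + b) m = first_rows A m *\<^sub>v x + vec_first b m"
proof (rule eq_vecI)
  fix i assume "i < dim_vec (first_rows A m *\<^sub>v x + vec_first b m)"
  then have i: "i < m" by (simp add: vec_first_def)
  have "row (first_rows A m) i = row A i"
    using A i \<open>m \<le> N\<close> by (intro eq_vecI) (auto simp: first_rows_def)
  then show "vec_first (A *\<^sub>v x + b) m $ i = (first_rows A m *\<^sub>v x + vec_first b m) $ i"
    using A b i \<open>m \<le> N\<close> by (simp add: vec_first_def first_rows_def)
qed (simp add: vec_first_def first_rows_def)

theorem theorem2:
  fixes n m p T Nx Nu Nc M :: nat
    and A B K P Q R Cx Cu :: "real mat" and d :: "real vec"
    and x_dat u_dat :: "nat \<Rightarrow> real vec"
    and U0 X0 X1 Ddag \<gamma> \<xi> H F G E S :: "real mat" and W :: "real vec"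
    and act :: "nat \<Rightarrow> nat set"
  assumes system: "A \<in> carrier_mat n n" "B \<in> carrier_mat n m"
    and traj_dims: "\<And>t. t \<le> T \<Longrightarrow> x_dat t \<in> carrier_vec n" "\<And>t. t < T \<Longrightarrow> u_dat t \<in> carrier_vec m"
    and traj: "\<And>t. t < T \<Longrightarrow> x_dat (Suc t) = A *\<^sub>v x_dat t + B *\<^sub>v u_dat t"
    and U0: "U0 = mat_of_cols m (map u_dat [0..<T])"
    and X0: "X0 = mat_of_cols n (map x_dat [0..<T])"
    and X1: "X1 = mat_of_cols n (map x_dat [1..<Suc T])"
    and rank: "vec_space.rank (m + n) (U0 @\<^sub>r X0) = n + m"
    and horizons: "1 \<le> Nx" "1 \<le> Nu" "1 \<le> Nc" "Nu \<le> Nx"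
    and weights: "sym_pos_semidef n Q" "sym_pos_semidef n P" "sym_pos_def m R"
    and gain: "K \<in> carrier_mat m n"
    and constr: "Cx \<in> carrier_mat p n" "Cu \<in> carrier_mat p m" "d \<in> carrier_vec p"
    and Ddag: "right_inverse (U0 @\<^sub>r X0) Ddag"
    and \<gamma>\<xi>: "\<gamma> \<in> carrier_mat n m" "\<xi> \<in> carrier_mat n n" "append_cols \<gamma> \<xi> = X1 * Ddag"
    and H: "H = cost_H \<gamma> \<xi> K Nu Nx P Q R"
    and F: "F = cost_F \<gamma> \<xi> K Nu Nx P Q R"
    and G: "G = constr_G \<gamma> \<xi> K Nu Nc Cx Cu"
    and W: "W = constr_W Nc d"
    and E: "E = constr_E \<gamma> \<xi> K Nu Nc Cx Cu"
    and S: "S = constr_S H F G E"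
    and enum: "bij_betw act {1..M} (optimal_active_sets H G W S)"
    and licq: "\<And>i. i \<in> {1..M} \<Longrightarrow> lin_indpt_rows (select_rows G (act i))"
  shows "\<forall>x \<in> carrier_vec n. (\<exists>z. qp_feasible G W S x z) \<longrightarrow>
    (\<exists>!z. qp_solution H G W S x z) \<and>
    (\<exists>i \<in> {1..M}. region_H H G S (act i) *\<^sub>v x \<le> region_K H G W (act i)) \<and>
    (\<forall>z U. qp_solution H G W S x z \<longrightarrow> U = z - (mat_inv H * F\<^sup>T) *\<^sub>v x \<longrightarrow>
      (\<forall>i \<in> {1..M}. region_H H G S (act i) *\<^sub>v x \<le> region_K H G W (act i) \<longrightarrow>
        U = law_F H F G S (act i) *\<^sub>v x + law_G H G W (act i) \<and>
        vec_first U m = first_rows (law_F H F G S (act i)) m *\<^sub>v x + vec_first (law_G H G W (act i)) m))"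
proof (intro ballI impI)
  let ?N = "m * Nu" and ?q = "Nc * p"
  have pd: "sym_pos_def ?N H"
    unfolding H by (rule sym_pos_def_cost_H[OF \<gamma>\<xi>(1,2) gain weights horizons(4)])
  have F_carrier: "F \<in> carrier_mat n ?N"
    using \<gamma>\<xi>(1,2) by (auto simp: F cost_F_def Let_def mat_sum_def)
  have G_carrier: "G \<in> carrier_mat ?q ?N"
    using \<gamma>\<xi>(1) constr(1) by (auto simp: G constr_G_def stack_mats_def)
  have W_carrier: "W \<in> carrier_vec ?q"
    using constr(3) by (auto simp: W constr_W_def stack_vecs_def)
  have "E \<in> carrier_mat ?q n"
    using \<gamma>\<xi>(2) constr(1) by (auto simp: E constr_E_def stack_mats_def)
  then have S_carrier: "S \<in> carrier_mat ?q n"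
    using F_carrier G_carrier pos_def_mat_inv(1)[OF pd] by (auto simp: S constr_S_def)
  note law = law_eq[OF pd F_carrier G_carrier S_carrier W_carrier]
  note region = region_iff[OF pd F_carrier G_carrier S_carrier W_carrier]
  have act: "act i \<subseteq> {..<?q}" if "i \<in> {1..M}" for i
    using bij_betw_apply[OF enum that] G_carrier by (auto simp: optimal_active_sets_def active_set_def)
  fix x assume x: "x \<in> carrier_vec n" and "\<exists>z. qp_feasible G W S x z"
  then obtain y where y: "y \<in> carrier_vec ?N" "G *\<^sub>v y \<le> W + S *\<^sub>v x"
    using G_carrier by (auto simp: qp_feasible_def)
  have b: "W + S *\<^sub>v x \<in> carrier_vec ?q" using W_carrier S_carrier x by simp
  obtain z where z: "qp_min H G (W + S *\<^sub>v x) z" using qp_min_exists[OF pd G_carrier b y] by blast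
  have unique: "z' = z" if "qp_solution H G W S x z'" for z'
    using qp_min_unique[OF pd G_carrier b _ z] that by (simp add: qp_solution_iff_qp_min)
  \<comment> \<open>Surjectivity of the enumeration gives this active set an index; the necessary
    conditions then place \<open>x\<close> in its region.\<close>
  have "active_set G W S x z \<in> optimal_active_sets H G W S"
    using x S_carrier z by (auto simp: optimal_active_sets_def qp_solution_iff_qp_min)
  then obtain i where i: "i \<in> {1..M}" "act i = active_set G W S x z"
    using bij_betw_imp_surj_on[OF enum] by (metis imageE)
  have region_i: "region_H H G S (act i) *\<^sub>v x \<le> region_K H G W (act i)"
  proof -
    have "act i = {j. j < ?q \<and> (G *\<^sub>v z) $ j = (W + S *\<^sub>v x) $ j}"
      using i(2) G_carrier by (simp add: active_set_def del: index_mult_mat_vec)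
    note kkt = qp_min_imp_kkt[OF pd G_carrier act[OF i(1)] licq[OF i(1)] b z this]
    have "G *\<^sub>v z \<le> W + S *\<^sub>v x" using z by (simp add: qp_min_def)
    then show ?thesis unfolding region[OF act[OF i(1)] licq[OF i(1)] x]
      using kkt by simp
  qed
  \<comment> \<open>Here \<open>act j\<close> may differ from the active set at \<open>z\<close>.
    The region condition alone makes its candidate optimal, and uniqueness identifies that candidate
    with \<open>z\<close>.\<close>
  have law_U: "U = law_F H F G S (act j) *\<^sub>v x + law_G H G W (act j) \<and>
      vec_first U m = first_rows (law_F H F G S (act j)) m *\<^sub>v x + vec_first (law_G H G W (act j)) m"
    if "qp_solution H G W S x z'" "U = z' - (mat_inv H * F\<^sup>T) *\<^sub>v x" "j \<in> {1..M}"
      "region_H H G S (act j) *\<^sub>v x \<le> region_K H G W (act j)" for z' U j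
  proof -
    note j = act[OF that(3)] licq[OF that(3)]
    have "qp_min H G (W + S *\<^sub>v x) (kkt_point H G (act j) (subvector (W + S *\<^sub>v x) (act j)))"
      using that(4) qp_min_kkt_point[OF pd G_carrier j b] unfolding region[OF j x] by blast
    then have "kkt_point H G (act j) (subvector (W + S *\<^sub>v x) (act j)) = z"
      by (rule qp_min_unique[OF pd G_carrier b _ z])
    then have U: "U = law_F H F G S (act j) *\<^sub>v x + law_G H G W (act j)"
      unfolding law[OF j x] using that(2) unique[OF that(1)] by simp
    have C: "mat_inv H * (select_rows G (act j))\<^sup>T * kkt_inv H G (act j) \<in> carrier_mat ?N (card (act j))"
      by (rule kkt_gain_carrier[OF pd F_carrier G_carrier S_carrier W_carrier j])
    have "law_F H F G S (act j) \<in> carrier_mat ?N n"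
      unfolding law_F_def using F_carrier pos_def_mat_inv(1)[OF pd] by (intro minus_carrier_mat) simp
    moreover have "law_G H G W (act j) \<in> carrier_vec ?N"
      unfolding law_G_def
      by (rule mult_mat_vec_carrier[OF C subvector_carrier[OF j(1) W_carrier]])
    moreover have "m \<le> ?N" using horizons(2) by simp
    ultimately show ?thesis using U vec_first_affine x by blast
  qed
  have "qp_solution H G W S x z" using z by (simp add: qp_solution_iff_qp_min)
  then have ex1: "\<exists>!z. qp_solution H G W S x z" using unique by (rule ex1I)
  have ex: "\<exists>i \<in> {1..M}. region_H H G S (act i) *\<^sub>v x \<le> region_K H G W (act i)"
    using region_i i(1) by (rule bexI)
  show "(\<exists>!z. qp_solution H G W S x z) \<and>
    (\<exists>i \<in> {1..M}. region_H H G S (act i) *\<^sub>v x \<le> region_K H G W (act i)) \<and>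
    (\<forall>z U. qp_solution H G W S x z \<longrightarrow> U = z - (mat_inv H * F\<^sup>T) *\<^sub>v x \<longrightarrow>
      (\<forall>i \<in> {1..M}. region_H H G S (act i) *\<^sub>v x \<le> region_K H G W (act i) \<longrightarrow>
        U = law_F H F G S (act i) *\<^sub>v x + law_G H G W (act i) \<and>
        vec_first U m = first_rows (law_F H F G S (act i)) m *\<^sub>v x + vec_first (law_G H G W (act i)) m))"
    by (rule conjI[OF ex1 conjI[OF ex]]) (intro allI impI ballI law_U)
qed

end
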